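(* Let $a\ge b>0$, let $k=1+\frac{2ab}{(a+b)^2}$, and let $s=\sqrt{\frac{b^4+2ab^3}{a^4+2ba^3}}$. Let $\mathcal{I}$ be the incircle family with parameters $a,b$, and let $\mathcal{C}$ be the confocal family affinely related to it, i.e., the image of $\mathcal{I}$ under the scaling $(x,y)\mapsto(s\,x,y)$. Then the locus $\Delta$ of cosine triples of the triangles in $\mathcal{I}$, and likewise of those in $\mathcal{C}$, is the equilateral cubic in the plane $c_1+c_2+c_3=k$ given implicitly, in the orthonormal coordinates $(u,v)$ of that plane, by $$\Delta(u,v):\quad 3\sqrt{6}\,(3u^2-v^2)\,v-9(k-3)(u^2+v^2)+(2k-3)(k+3)^2=0.$$
   Context: Incircle family with parameters $a,b$: the set of all (nondegenerate) triangles inscribed in the ellipse $x^2/a^2+y^2/b^2=1$ whose three sides are tangent to the concentric circle of radius $r=ab/(a+b)$ centered at the origin. (By Poncelet's porism, with this value of $r$, every point of the ellipse is a vertex of exactly one such triangle.) Confocal family: for an ellipse and a confocal ellipse inside it such that triangles inscribed in the outer one and circumscribed about the inner one exist, the set of all such triangles. The image of the incircle family under $(x,y)\mapsto(sx,y)$ with the stated $s$ is a confocal family, with outer ellipse of semi-axes $sa,b$ and inner ellipse of semi-axes $s\frac{ab}{a+b},\frac{ab}{a+b}$. Cosine triple of a triangle: $(c_1,c_2,c_3)=(\cos\theta_1,\cos\theta_2,\cos\theta_3)\in\mathbb{R}^3$, where $\theta_1,\theta_2,\theta_3$ are the internal angles at its vertices $P_1,P_2,P_3$. The locus of cosine triples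 of a family is the curve swept by these triples over the triangles of the family. For both families above, $c_1+c_2+c_3=k$ for every triangle. Coordinates on the plane $c_1+c_2+c_3=k$: the origin is $(k/3,k/3,k/3)$, and a point of the plane has coordinates $(u,v)$ when $$(c_1,c_2,c_3)=\left(\tfrac k3,\tfrac k3,\tfrac k3\right)+\tfrac{u}{\sqrt2}(-1,1,0)+\tfrac{v}{\sqrt6}(1,1,-2).$$ Equilateral cubic: a plane cubic whose three asymptotic directions pairwise make angles of $60^\circ$.
   Formalization: The locus is proved equal to the part of the cubic whose points have all coordinates c1, c2, c3 in [-1,1], not to the whole real cubic, which is unbounded; e.g. for a=b the cubic contains (5/4,5/4,-1), which is no cosine triple. *)

theory Defs
  imports "HOL-Analysis.Analysis"
begin

(* A triangle is given by its three vertices in order, so a family contains a triangle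
   together with all relabellings of its vertices. *)
type_synonym triangle = "(real^2) \<times> (real^2) \<times> (real^2)"

definition ellipse :: "real \<Rightarrow> real \<Rightarrow> (real^2) set" where
  "ellipse A B = {p. (p$1)\<^sup>2 / A\<^sup>2 + (p$2)\<^sup>2 / B\<^sup>2 = 1}"

definition ellipse_foci :: "real \<Rightarrow> real \<Rightarrow> (real^2) set" where
  "ellipse_foci A B =
     (if A \<ge> B then {vector [sqrt (A\<^sup>2 - B\<^sup>2), 0], vector [- sqrt (A\<^sup>2 - B\<^sup>2), 0]}
      else {vector [0, sqrt (B\<^sup>2 - A\<^sup>2)], vector [0, - sqrt (B\<^sup>2 - A\<^sup>2)]})"

(* For an ellipse or a circle E, a line is tangent iff it meets E in exactly one point. *)
definition side_tangent :: "real^2 \<Rightarrow> real^2 \<Rightarrow> (real^2) set \<Rightarrow> bool" where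
  "side_tangent P Q E \<longleftrightarrow> (\<exists>!T. T \<in> affine hull {P, Q} \<inter> E)"

definition poncelet_family :: "(real^2) set \<Rightarrow> (real^2) set \<Rightarrow> triangle set" where
  "poncelet_family Out In =
     {(P1, P2, P3). \<not> collinear {P1, P2, P3}
        \<and> P1 \<in> Out \<and> P2 \<in> Out \<and> P3 \<in> Out
        \<and> side_tangent P1 P2 In \<and> side_tangent P2 P3 In \<and> side_tangent P3 P1 In}"

definition incircle_family :: "real \<Rightarrow> real \<Rightarrow> triangle set" where
  "incircle_family a b = poncelet_family (ellipse a b) (sphere 0 (a * b / (a + b)))"

(* Outer ellipse with semi-axes A, B and inner ellipse with semi-axes A', B'. *)
definition is_confocal_family :: "real \<Rightarrow> real \<Rightarrow> real \<Rightarrow> real \<Rightarrow> triangle set \<Rightarrow> bool" where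
  "is_confocal_family A B A' B' F \<longleftrightarrow>
     0 < A' \<and> A' < A \<and> 0 < B' \<and> B' < B \<and> ellipse_foci A B = ellipse_foci A' B'
     \<and> F = poncelet_family (ellipse A B) (ellipse A' B') \<and> F \<noteq> {}"

definition scale_x :: "real \<Rightarrow> real^2 \<Rightarrow> real^2" where
  "scale_x s p = vector [s * p$1, p$2]"

definition scale_triangle :: "real \<Rightarrow> triangle \<Rightarrow> triangle" where
  "scale_triangle s = (\<lambda>(P1, P2, P3). (scale_x s P1, scale_x s P2, scale_x s P3))"

definition vector_angle :: "real^2 \<Rightarrow> real^2 \<Rightarrow> real" where
  "vector_angle x y = arccos (x \<bullet> y / (norm x * norm y))"

(* The internal angle at the first argument. *)
definition interior_angle :: "real^2 \<Rightarrow> real^2 \<Rightarrow> real^2 \<Rightarrow> real" where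
  "interior_angle P Q R = vector_angle (Q - P) (R - P)"

definition cosine_triple :: "triangle \<Rightarrow> real^3" where
  "cosine_triple = (\<lambda>(P1, P2, P3).
     vector [cos (interior_angle P1 P2 P3),
             cos (interior_angle P2 P3 P1),
             cos (interior_angle P3 P1 P2)])"

definition cosine_locus :: "triangle set \<Rightarrow> (real^3) set" where
  "cosine_locus F = cosine_triple ` F"

definition plane_point :: "real \<Rightarrow> real \<Rightarrow> real \<Rightarrow> real^3" where
  "plane_point k u v = vector [k/3, k/3, k/3]
     + (u / sqrt 2) *\<^sub>R vector [-1, 1, 0] + (v / sqrt 6) *\<^sub>R vector [1, 1, -2]"

definition Delta :: "real \<Rightarrow> real \<Rightarrow> real \<Rightarrow> real" where
  "Delta k u v = 3 * sqrt 6 * (3 * u\<^sup>2 - v\<^sup>2) * v - 9 * (k - 3) * (u\<^sup>2 + v\<^sup>2)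
                 + (2 * k - 3) * (k + 3)\<^sup>2"

(* The whole real zero set. It has unbounded branches, on which some coordinate exceeds 1 in
   absolute value, so only its part with all coordinates in [-1, 1] can consist of cosine triples. *)
definition Delta_curve :: "real \<Rightarrow> (real^3) set" where
  "Delta_curve k = {plane_point k u v | u v. Delta k u v = 0}"

(* c i j is the coefficient of u^i v^j. *)
definition cubic_poly :: "(nat \<Rightarrow> nat \<Rightarrow> real) \<Rightarrow> real \<Rightarrow> real \<Rightarrow> real" where
  "cubic_poly c u v = (\<Sum>i\<le>3. \<Sum>j\<le>3 - i. c i j * u ^ i * v ^ j)"

definition cubic_leading_form :: "(nat \<Rightarrow> nat \<Rightarrow> real) \<Rightarrow> real \<Rightarrow> real \<Rightarrow> real" where
  "cubic_leading_form c u v = (\<Sum>i\<le>3. c i (3 - i) * u ^ i * v ^ (3 - i))"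

(* The directions of the real points at infinity of the cubic, as lines through the origin. *)
definition asymptotic_directions :: "(nat \<Rightarrow> nat \<Rightarrow> real) \<Rightarrow> (real^2) set set" where
  "asymptotic_directions c = {span {d} | d. d \<noteq> 0 \<and> cubic_leading_form c (d$1) (d$2) = 0}"

(* The angle of two lines is the non-obtuse one. *)
definition line_angle :: "(real^2) set \<Rightarrow> (real^2) set \<Rightarrow> real \<Rightarrow> bool" where
  "line_angle L M \<phi> \<longleftrightarrow> (\<exists>x y. x \<noteq> 0 \<and> y \<noteq> 0 \<and> L = span {x} \<and> M = span {y}
     \<and> \<phi> \<le> pi / 2 \<and> \<phi> = vector_angle x y)"

(* Having exactly three asymptotic directions forces the leading form to be nonzero, so the
   degree is exactly 3; the coefficients c are determined by the function F. *)
definition equilateral_cubic :: "(real \<Rightarrow> real \<Rightarrow> real) \<Rightarrow> bool" where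
  "equilateral_cubic F \<longleftrightarrow> (\<exists>c. (\<forall>u v. F u v = cubic_poly c u v)
     \<and> card (asymptotic_directions c) = 3
     \<and> (\<forall>L \<in> asymptotic_directions c. \<forall>M \<in> asymptotic_directions c.
          L \<noteq> M \<longrightarrow> line_angle L M (pi / 3)))"

end

theory Submission
  imports Defs
begin

text \<open>
  Write a point of the ellipse with semi-axes \<open>A\<close>, \<open>B\<close> as \<open>(A * Re w, B * Im w)\<close> with a complex
  number \<open>w\<close> of modulus 1. Put \<open>q = (a - b) / (a + b)\<close>. The inner conics of both families have
  semi-axes \<open>A * (1 - q) / 2\<close> and \<open>B * (1 + q) / 2\<close>, and a chord with parameters \<open>w\<close>, \<open>z\<close> touches
  this conic iff \<open>\<bar>w + z\<bar> = \<bar>q - w * z\<bar>\<close>. Hence both families are images of one set of triples,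
  namely the distinct unit numbers with \<open>w1 * w2 + w2 * w3 + w3 * w1 = q\<close>
  (\<open>poncelet_family_eq_image\<close>).

  Conjugating this equation gives \<open>w1 + w2 + w3 = q * w1 * w2 * w3\<close>, so the two elementary symmetric
  functions have modulus \<open>q\<close>. For the incircle family the equation also factors the side vectors:
  the side opposite to the vertex of \<open>w3\<close> is a real multiple of \<open>\<i> * w3\<close>. The angle at the first vertex
  therefore has cosine \<open>- Re (w2 * cnj w3)\<close>, up to a sign that an estimate settles
  (\<open>cosine_triple_incircle\<close>). Now \<open>\<bar>w1 + w2 + w3\<bar> = q\<close> says that the cosines have sum
  \<open>(3 - q^2) / 2 = k\<close>, and the three numbers \<open>w2 * cnj w3\<close>, \<open>w3 * cnj w1\<close>, \<open>w1 * cnj w2\<close> have product 1,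
  which is the relation \<open>c1^2 + c2^2 + c3^2 + 2 * c1 * c2 * c3 = 1\<close>. On the plane of sum \<open>k\<close> this
  relation is the equation of the cubic (\<open>Delta_curve_iff\<close>). Conversely, from a point of the cubic in
  the cube the unit numbers can be rebuilt up to a common rotation, and a rotation brings
  \<open>w1 * w2 + w2 * w3 + w3 * w1\<close>, which has modulus \<open>q\<close>, to the value \<open>q\<close>
  (\<open>ex_poncelet_triple_with_cosines\<close>).

  The confocal family has the same locus because each of its triangles is similar to one of the
  incircle family and conversely. Given an incircle triangle with parameters \<open>w\<close>, consider the
  triangle inscribed in the ellipse with semi-axes \<open>s * a\<close>, \<open>b\<close> whose sides are perpendicular to
  those of the given one, that is, parallel to \<open>w1\<close>, \<open>w2\<close>, \<open>w3\<close>. Confocality is exactly the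
  equation between \<open>q\<close> and the axes that makes the parameters of the new triangle satisfy
  \<open>w1 * w2 + w2 * w3 + w3 * w1 = q\<close> again (\<open>sum_parallel_chord_product\<close>). The correspondence between
  parameter triples is symmetric (\<open>perpendicular_sides_sym\<close>), hence every confocal triangle occurs.
\<close>

section \<open>Triangles between two ellipses\<close>

definition ellipse_point :: "real \<Rightarrow> real \<Rightarrow> complex \<Rightarrow> real^2" where
  "ellipse_point A B w = vector [A * Re w, B * Im w]"

definition ellipse_triangle :: "real \<Rightarrow> real \<Rightarrow> complex \<times> complex \<times> complex \<Rightarrow> triangle" where
  "ellipse_triangle A B =
     (\<lambda>(w1, w2, w3). (ellipse_point A B w1, ellipse_point A B w2, ellipse_point A B w3))"

text \<open>
  Parameters of the triangles inscribed in an ellipse and circumscribed about the conic attached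
  to \<open>q\<close>; the axes of the ellipse do not enter, since an affine map changes them at will.
\<close>

definition poncelet_triples :: "real \<Rightarrow> (complex \<times> complex \<times> complex) set" where
  "poncelet_triples q =
     {(w1, w2, w3). cmod w1 = 1 \<and> cmod w2 = 1 \<and> cmod w3 = 1
        \<and> w1 \<noteq> w2 \<and> w2 \<noteq> w3 \<and> w3 \<noteq> w1 \<and> w1 * w2 + w2 * w3 + w3 * w1 = of_real q}"

lemma ellipse_point_nth [simp]:
  "ellipse_point A B w $ 1 = A * Re w" "ellipse_point A B w $ 2 = B * Im w"
  by (simp_all add: ellipse_point_def)

lemma ellipse_point_inject:
  assumes "A > 0" "B > 0"
  shows "ellipse_point A B w = ellipse_point A B z \<longleftrightarrow> w = z"
  using assms by (auto simp: vec_eq_iff forall_2 complex_eq_iff)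

lemma ellipse_eq_image:
  assumes "A > 0" "B > 0"
  shows "ellipse A B = ellipse_point A B ` {w. cmod w = 1}"
proof (rule set_eqI, rule iffI)
  fix p assume p: "p \<in> ellipse A B"
  have "p = ellipse_point A B (Complex (p$1 / A) (p$2 / B))"
    using assms by (simp add: vec_eq_iff forall_2)
  moreover have "cmod (Complex (p$1 / A) (p$2 / B)) = 1"
    using p by (simp add: ellipse_def cmod_def power_divide)
  ultimately show "p \<in> ellipse_point A B ` {w. cmod w = 1}" by blast
next
  fix p assume "p \<in> ellipse_point A B ` {w. cmod w = 1}"
  then show "p \<in> ellipse A B"
    using assms by (auto simp: ellipse_def cmod_def power_mult_distrib)
qed

lemma ex1_quadratic_root_iff:
  fixes \<alpha> \<beta> \<gamma> :: real
  assumes "\<alpha> \<noteq> 0"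
  shows "(\<exists>!t. \<alpha> * t\<^sup>2 + 2 * \<beta> * t + \<gamma> = 0) \<longleftrightarrow> \<beta>\<^sup>2 = \<alpha> * \<gamma>"
proof
  assume "\<exists>!t. \<alpha> * t\<^sup>2 + 2 * \<beta> * t + \<gamma> = 0"
  then obtain t where t: "\<alpha> * t\<^sup>2 + 2 * \<beta> * t + \<gamma> = 0"
    and u: "\<And>t'. \<alpha> * t'\<^sup>2 + 2 * \<beta> * t' + \<gamma> = 0 \<Longrightarrow> t' = t" by blast
  have e: "\<alpha> * (- 2 * \<beta> / \<alpha> - t)\<^sup>2 + 2 * \<beta> * (- 2 * \<beta> / \<alpha> - t) + \<gamma> = \<alpha> * t\<^sup>2 + 2 * \<beta> * t + \<gamma>"
    using assms by (simp add: field_simps power2_eq_square)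
  have "- 2 * \<beta> / \<alpha> - t = t" by (rule u[OF trans[OF e t]])
  then have "\<beta> = - (\<alpha> * t)" using assms by (simp add: field_simps)
  then show "\<beta>\<^sup>2 = \<alpha> * \<gamma>" using t by algebra
next
  assume e: "\<beta>\<^sup>2 = \<alpha> * \<gamma>"
  have "\<alpha> * (\<alpha> * t\<^sup>2 + 2 * \<beta> * t + \<gamma>) = (\<alpha> * t + \<beta>)\<^sup>2" for t
    using e by algebra
  then have "\<alpha> * t\<^sup>2 + 2 * \<beta> * t + \<gamma> = 0 \<longleftrightarrow> t = - \<beta> / \<alpha>" for t
    using assms by (smt (verit, best) mult_eq_0_iff nonzero_eq_divide_eq power2_eq_square mult.commute)
  then show "\<exists>!t. \<alpha> * t\<^sup>2 + 2 * \<beta> * t + \<gamma> = 0" by simp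
qed

lemma ex1_range_Int_iff:
  assumes "inj f"
  shows "(\<exists>!y. y \<in> range f \<inter> E) \<longleftrightarrow> (\<exists>!x. f x \<in> E)"
  using assms unfolding inj_def by (auto simp: Ex1_def)

text \<open>
  Restricted to the line through the two points, the equation of the inner conic is a quadratic
  equation. For unit \<open>w\<close>, \<open>z\<close> its discriminant is a positive multiple of
  \<open>\<bar>q - w * z\<bar>^2 - \<bar>w + z\<bar>^2\<close>.
\<close>

lemma side_tangent_iff_cmod:
  assumes "A > 0" "B > 0" "0 \<le> q" "q < 1" "cmod w = 1" "cmod z = 1" "w \<noteq> z"
  shows "side_tangent (ellipse_point A B w) (ellipse_point A B z)
           (ellipse (A * (1 - q) / 2) (B * (1 + q) / 2))
         \<longleftrightarrow> cmod (w + z) = cmod (of_real q - w * z)"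
proof -
  define x1 y1 x2 y2 where xy: "x1 = Re w" "y1 = Im w" "x2 = Re z" "y2 = Im z"
  define dx dy where d: "dx = x2 - x1" "dy = y2 - y1"
  define \<alpha> \<beta> \<gamma> where abc: "\<alpha> = (1 + q)\<^sup>2 * dx\<^sup>2 + (1 - q)\<^sup>2 * dy\<^sup>2"
    "\<beta> = (1 + q)\<^sup>2 * x1 * dx + (1 - q)\<^sup>2 * y1 * dy"
    "\<gamma> = (1 + q)\<^sup>2 * x1\<^sup>2 + (1 - q)\<^sup>2 * y1\<^sup>2 - ((1 - q\<^sup>2) / 2)\<^sup>2"
  define P where "P t = ellipse_point A B w + t *\<^sub>R (ellipse_point A B z - ellipse_point A B w)" for t
  have u: "x1\<^sup>2 + y1\<^sup>2 = 1" "x2\<^sup>2 + y2\<^sup>2 = 1"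
    using assms(5,6) by (simp_all add: cmod_def xy)
  have dd: "dx\<^sup>2 + dy\<^sup>2 > 0"
    using assms(7) unfolding xy d complex_eq_iff by (metis eq_iff_diff_eq_0 sum_power2_gt_zero_iff)
  have q: "1 - q > 0" "1 + q > 0" using assms by auto
  have \<alpha>: "\<alpha> > 0"
  proof -
    have "\<alpha> = (1 - q)\<^sup>2 * (dx\<^sup>2 + dy\<^sup>2) + 4 * (q * dx\<^sup>2)"
      unfolding abc by algebra
    moreover have "(1 - q)\<^sup>2 * (dx\<^sup>2 + dy\<^sup>2) > 0" using dd q by simp
    moreover have "q * dx\<^sup>2 \<ge> 0" using assms(3) by simp
    ultimately show ?thesis by linarith
  qed
  have "inj P"
    unfolding P_def inj_def using assms ellipse_point_inject by auto
  have mem: "P t \<in> ellipse (A * (1 - q) / 2) (B * (1 + q) / 2) \<longleftrightarrow> \<alpha> * t\<^sup>2 + 2 * \<beta> * t + \<gamma> = 0" for t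
  proof -
    have "P t \<in> ellipse (A * (1 - q) / 2) (B * (1 + q) / 2) \<longleftrightarrow>
       (A * (x1 + t * dx))\<^sup>2 / (A * (1 - q) / 2)\<^sup>2 + (B * (y1 + t * dy))\<^sup>2 / (B * (1 + q) / 2)\<^sup>2 = 1"
    proof -
      have "P t $ 1 = A * (x1 + t * dx)" "P t $ 2 = B * (y1 + t * dy)"
        by (simp_all add: P_def xy d algebra_simps)
      then show ?thesis by (simp only: ellipse_def mem_Collect_eq)
    qed
    also have "(A * (x1 + t * dx))\<^sup>2 / (A * (1 - q) / 2)\<^sup>2 = (x1 + t * dx)\<^sup>2 * 4 / (1 - q)\<^sup>2"
      using assms(1) by (simp add: power_mult_distrib power_divide)
    also have "(B * (y1 + t * dy))\<^sup>2 / (B * (1 + q) / 2)\<^sup>2 = (y1 + t * dy)\<^sup>2 * 4 / (1 + q)\<^sup>2"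
      using assms(2) by (simp add: power_mult_distrib power_divide)
    also have "(x1 + t * dx)\<^sup>2 * 4 / (1 - q)\<^sup>2 + (y1 + t * dy)\<^sup>2 * 4 / (1 + q)\<^sup>2 = 1 \<longleftrightarrow>
      (x1 + t * dx)\<^sup>2 * 4 * (1 + q)\<^sup>2 + (y1 + t * dy)\<^sup>2 * 4 * (1 - q)\<^sup>2 = (1 - q)\<^sup>2 * (1 + q)\<^sup>2"
      using q by (subst add_frac_eq) auto
    also have "\<dots> \<longleftrightarrow> \<alpha> * t\<^sup>2 + 2 * \<beta> * t + \<gamma> = 0"
    proof -
      have *: "(x1 + t * dx)\<^sup>2 * 4 * (1 + q)\<^sup>2 + (y1 + t * dy)\<^sup>2 * 4 * (1 - q)\<^sup>2 - (1 - q)\<^sup>2 * (1 + q)\<^sup>2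
        = 4 * (\<alpha> * t\<^sup>2 + 2 * \<beta> * t + \<gamma>)"
        unfolding abc by (simp add: power2_eq_square field_simps)
      show ?thesis by (subst eq_iff_diff_eq_0) (simp only: * mult_eq_0_iff, simp)
    qed
    finally show ?thesis .
  qed
  have "side_tangent (ellipse_point A B w) (ellipse_point A B z)
           (ellipse (A * (1 - q) / 2) (B * (1 + q) / 2)) \<longleftrightarrow>
        (\<exists>!t. P t \<in> ellipse (A * (1 - q) / 2) (B * (1 + q) / 2))"
    unfolding side_tangent_def affine_hull_2_alt P_def[symmetric] ex1_range_Int_iff[OF \<open>inj P\<close>] ..
  also have "\<dots> \<longleftrightarrow> \<beta>\<^sup>2 = \<alpha> * \<gamma>"
    unfolding mem using \<alpha> by (intro ex1_quadratic_root_iff) auto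
  also have "\<dots> \<longleftrightarrow> (x1 + x2)\<^sup>2 + (y1 + y2)\<^sup>2 = (q - (x1 * x2 - y1 * y2))\<^sup>2 + (x1 * y2 + y1 * x2)\<^sup>2"
  proof -
    define N M where NM: "N = (q - (x1 * x2 - y1 * y2))\<^sup>2 + (x1 * y2 + y1 * x2)\<^sup>2"
      "M = (x1 + x2)\<^sup>2 + (y1 + y2)\<^sup>2"
    have e1: "4 * (\<beta>\<^sup>2 - \<alpha> * \<gamma>) = (1 - q\<^sup>2)\<^sup>2 * (\<alpha> - 4 * (x1 * dy - y1 * dx)\<^sup>2)"
    proof -
      define h where "h = (1 - q\<^sup>2) / 2"
      have "2 * h = 1 - q\<^sup>2" by (simp add: h_def)
      then show ?thesis unfolding abc h_def[symmetric] by algebra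
    qed
    have e2: "\<alpha> = (dx\<^sup>2 + dy\<^sup>2) * N"
      unfolding abc d NM using u by algebra
    have e3: "4 * (x1 * dy - y1 * dx)\<^sup>2 = (dx\<^sup>2 + dy\<^sup>2) * M"
      unfolding d NM using u by algebra
    have "4 * (\<beta>\<^sup>2 - \<alpha> * \<gamma>) = ((1 - q\<^sup>2)\<^sup>2 * (dx\<^sup>2 + dy\<^sup>2)) * (N - M)"
      unfolding e1 e3 unfolding e2 by (simp only: right_diff_distrib mult.assoc)
    moreover have "(1 - q\<^sup>2)\<^sup>2 * (dx\<^sup>2 + dy\<^sup>2) \<noteq> 0"
      using assms(3,4) dd by (auto simp: power2_eq_1_iff)
    ultimately have "\<beta>\<^sup>2 = \<alpha> * \<gamma> \<longleftrightarrow> N = M"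
      by (metis eq_iff_diff_eq_0 mult_eq_0_iff zero_neq_numeral)
    then show ?thesis unfolding NM by (simp only: eq_commute)
  qed
  also have "\<dots> \<longleftrightarrow> cmod (w + z) = cmod (of_real q - w * z)"
  proof -
    have "(- a - b)\<^sup>2 = (a + b)\<^sup>2" for a b :: real
      by (simp add: power2_eq_square algebra_simps)
    then show ?thesis by (simp add: cmod_def xy)
  qed
  finally show ?thesis .
qed

lemma cnj_of_unit:
  assumes "cmod w = 1" shows "cnj w * w = 1" "w \<noteq> 0"
  using assms complex_norm_square[of w] by (auto simp: mult.commute)

lemma one_plus_mult_unit_nonzero:
  assumes "cmod x = 1" "\<bar>t\<bar> < 1" shows "1 + of_real t * x \<noteq> 0"
proof
  assume "1 + of_real t * x = 0"
  then have "of_real t * x = -1" by (simp add: eq_neg_iff_add_eq_0 add.commute)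
  then have "cmod (of_real t * x) = 1" by simp
  then show False using assms by (simp add: norm_mult)
qed

text \<open>
  Replacing conjugates by inverses makes the tangency condition quadratic in each of \<open>w\<close> and \<open>z\<close>, so
  that through every point there are two tangents and Vieta's formulas apply to them.
\<close>

lemma cmod_tangent_iff_algebraic:
  assumes "cmod w = 1" "cmod z = 1"
  shows "cmod (w + z) = cmod (of_real q - w * z) \<longleftrightarrow>
         (w + z)\<^sup>2 = (of_real q - w * z) * (of_real q * (w * z) - 1)"
proof -
  have "cmod (w + z) = cmod (of_real q - w * z) \<longleftrightarrow>
     (w + z) * cnj (w + z) = (of_real q - w * z) * cnj (of_real q - w * z)"
    by (metis complex_norm_square norm_ge_zero of_real_eq_iff power2_eq_iff_nonneg)
  also have "\<dots> \<longleftrightarrow> (w * z) * ((w + z) * cnj (w + z)) = (w * z) * ((of_real q - w * z) * cnj (of_real q - w * z))"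
    using cnj_of_unit assms by simp
  also have "(w * z) * ((w + z) * cnj (w + z)) = (w + z)\<^sup>2"
    using cnj_of_unit(1)[OF assms(1)] cnj_of_unit(1)[OF assms(2)] unfolding complex_cnj_add by algebra
  also have "(w * z) * ((of_real q - w * z) * cnj (of_real q - w * z)) = (of_real q - w * z) * (of_real q * (w * z) - 1)"
    using cnj_of_unit(1)[OF assms(1)] cnj_of_unit(1)[OF assms(2)]
    unfolding complex_cnj_diff complex_cnj_mult complex_cnj_complex_of_real by algebra
  finally show ?thesis .
qed

text \<open>
  This is Poncelet's porism in the present case: \<open>w2\<close> and \<open>w3\<close> are the two roots of the quadratic
  equation for the tangents through \<open>w1\<close>, and the resulting relation is symmetric in all three.
\<close>

lemma two_tangents_imp_poncelet:
  fixes w1 w2 w3 :: complex and q :: real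
  assumes u: "cmod w1 = 1" and q: "\<bar>q\<bar> < 1" and ne: "w2 \<noteq> w3"
    and t2: "(w1 + w2)\<^sup>2 = (of_real q - w1 * w2) * (of_real q * (w1 * w2) - 1)"
    and t3: "(w1 + w3)\<^sup>2 = (of_real q - w1 * w3) * (of_real q * (w1 * w3) - 1)"
  shows "w1 * w2 + w2 * w3 + w3 * w1 = of_real q"
proof -
  let ?q = "of_real q :: complex"
  have nz: "1 + ?q * w1\<^sup>2 \<noteq> 0"
    using one_plus_mult_unit_nonzero[of "w1\<^sup>2" q] u q by (simp add: norm_power)
  \<comment> \<open>Subtracting the two tangency equations leaves the factor \<open>w2 - w3\<close>.\<close>
  have "(w2 - w3) * ((w2 + w3) * (1 + ?q * w1\<^sup>2) - (?q\<^sup>2 - 1) * w1) = 0"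
    using t2 t3 by algebra
  then have s: "(w2 + w3) * (1 + ?q * w1\<^sup>2) = (?q\<^sup>2 - 1) * w1"
    using ne by auto
  then have p: "w2 * w3 * (1 + ?q * w1\<^sup>2) = w1\<^sup>2 + ?q"
    using t2 by algebra
  from s p have "(w1 * w2 + w2 * w3 + w3 * w1) * (1 + ?q * w1\<^sup>2) = ?q * (1 + ?q * w1\<^sup>2)"
    by algebra
  with nz show ?thesis by simp
qed

lemma poncelet_imp_cmod_tangent:
  fixes w1 w2 w3 :: complex
  assumes "w1 * w2 + w2 * w3 + w3 * w1 = of_real q" "cmod w3 = 1"
  shows "cmod (w1 + w2) = cmod (of_real q - w1 * w2)"
proof -
  have "of_real q - w1 * w2 = w3 * (w1 + w2)" using assms(1) by (simp add: algebra_simps)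
  then show ?thesis using assms(2) by (simp add: norm_mult)
qed

text \<open>
  A point \<open>w2 + c * (w1 - w2)\<close> of a chord of the unit circle has modulus 1 only for \<open>c = 0\<close> and
  \<open>c = 1\<close>.
\<close>

lemma not_collinear_ellipse_points:
  assumes AB: "A > 0" "B > 0" and u: "cmod w1 = 1" "cmod w2 = 1" "cmod w3 = 1"
  shows "\<not> collinear {ellipse_point A B w1, ellipse_point A B w2, ellipse_point A B w3} \<longleftrightarrow>
         w1 \<noteq> w2 \<and> w2 \<noteq> w3 \<and> w3 \<noteq> w1"
proof
  assume "\<not> collinear {ellipse_point A B w1, ellipse_point A B w2, ellipse_point A B w3}"
  then show "w1 \<noteq> w2 \<and> w2 \<noteq> w3 \<and> w3 \<noteq> w1"
    by (auto simp: insert_commute)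
next
  assume d: "w1 \<noteq> w2 \<and> w2 \<noteq> w3 \<and> w3 \<noteq> w1"
  show "\<not> collinear {ellipse_point A B w1, ellipse_point A B w2, ellipse_point A B w3}"
  proof
    assume "collinear {ellipse_point A B w1, ellipse_point A B w2, ellipse_point A B w3}"
    then have "collinear {0, ellipse_point A B w1 - ellipse_point A B w2, ellipse_point A B w3 - ellipse_point A B w2}"
      by (simp add: collinear_3)
    then obtain c where c: "ellipse_point A B w3 - ellipse_point A B w2 = c *\<^sub>R (ellipse_point A B w1 - ellipse_point A B w2)"
      using d ellipse_point_inject[OF AB] by (auto simp: collinear_lemma)
    have r: "Re w3 - Re w2 = c * (Re w1 - Re w2)"
    proof -
      have "A * (Re w3 - Re w2) = A * (c * (Re w1 - Re w2))"
        using arg_cong[OF c, of "\<lambda>v. v$1"] by (simp add: algebra_simps)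
      then show ?thesis using AB by simp
    qed
    have i: "Im w3 - Im w2 = c * (Im w1 - Im w2)"
    proof -
      have "B * (Im w3 - Im w2) = B * (c * (Im w1 - Im w2))"
        using arg_cong[OF c, of "\<lambda>v. v$2"] by (simp add: algebra_simps)
      then show ?thesis using AB by simp
    qed
    have n: "(Re w1)\<^sup>2 + (Im w1)\<^sup>2 = 1" "(Re w2)\<^sup>2 + (Im w2)\<^sup>2 = 1" "(Re w3)\<^sup>2 + (Im w3)\<^sup>2 = 1"
      using u by (simp_all add: cmod_def)
    have "c * (c - 1) * ((Re w1 - Re w2)\<^sup>2 + (Im w1 - Im w2)\<^sup>2) = 0"
      using r i n by algebra
    moreover have "(Re w1 - Re w2)\<^sup>2 + (Im w1 - Im w2)\<^sup>2 \<noteq> 0"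
      using d by (simp add: complex_eq_iff sum_power2_eq_zero_iff)
    ultimately have "c = 0 \<or> c = 1" by auto
    then show False using r i d by (auto simp: complex_eq_iff)
  qed
qed

lemma poncelet_family_eq_image:
  assumes AB: "A > 0" "B > 0" and q: "0 \<le> q" "q < 1"
  shows "poncelet_family (ellipse A B) (ellipse (A * (1 - q) / 2) (B * (1 + q) / 2))
       = ellipse_triangle A B ` poncelet_triples q"
proof -
  let ?T = "ellipse_point A B" and ?E = "ellipse (A * (1 - q) / 2) (B * (1 + q) / 2)"
  have "(?T w1, ?T w2, ?T w3) \<in> poncelet_family (ellipse A B) ?E \<longleftrightarrow> (w1, w2, w3) \<in> poncelet_triples q"
    if u: "cmod w1 = 1" "cmod w2 = 1" "cmod w3 = 1" for w1 w2 w3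
  proof (cases "w1 \<noteq> w2 \<and> w2 \<noteq> w3 \<and> w3 \<noteq> w1")
    case True
    have "(?T w1, ?T w2, ?T w3) \<in> poncelet_family (ellipse A B) ?E \<longleftrightarrow>
      cmod (w1 + w2) = cmod (of_real q - w1 * w2) \<and> cmod (w2 + w3) = cmod (of_real q - w2 * w3)
      \<and> cmod (w3 + w1) = cmod (of_real q - w3 * w1)"
      using True u AB q not_collinear_ellipse_points[OF AB u]
      by (simp add: poncelet_family_def ellipse_eq_image[OF AB] side_tangent_iff_cmod)
    also have "\<dots> \<longleftrightarrow> w1 * w2 + w2 * w3 + w3 * w1 = of_real q"
    proof
      assume "cmod (w1 + w2) = cmod (of_real q - w1 * w2) \<and> cmod (w2 + w3) = cmod (of_real q - w2 * w3)
      \<and> cmod (w3 + w1) = cmod (of_real q - w3 * w1)"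
      then have "cmod (w1 + w2) = cmod (of_real q - w1 * w2)" "cmod (w1 + w3) = cmod (of_real q - w1 * w3)"
        by (simp_all add: add.commute mult.commute)
      then show "w1 * w2 + w2 * w3 + w3 * w1 = of_real q"
        using two_tangents_imp_poncelet[of w1 q w2 w3] True u q by (simp add: cmod_tangent_iff_algebraic)
    next
      assume "w1 * w2 + w2 * w3 + w3 * w1 = of_real q"
      then show "cmod (w1 + w2) = cmod (of_real q - w1 * w2) \<and> cmod (w2 + w3) = cmod (of_real q - w2 * w3)
      \<and> cmod (w3 + w1) = cmod (of_real q - w3 * w1)"
        using poncelet_imp_cmod_tangent[of w1 w2 w3 q] poncelet_imp_cmod_tangent[of w2 w3 w1 q]
          poncelet_imp_cmod_tangent[of w3 w1 w2 q] u by (simp add: algebra_simps)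
    qed
    finally show ?thesis using True u by (simp add: poncelet_triples_def)
  next
    case False
    then show ?thesis
      using not_collinear_ellipse_points[OF AB u] by (auto simp: poncelet_family_def poncelet_triples_def)
  qed
  note mem = this
  show ?thesis
  proof (rule set_eqI, rule iffI)
    fix t assume t: "t \<in> poncelet_family (ellipse A B) ?E"
    then obtain P1 P2 P3 where tt: "t = (P1, P2, P3)" "P1 \<in> ellipse A B" "P2 \<in> ellipse A B" "P3 \<in> ellipse A B"
      by (auto simp: poncelet_family_def)
    then obtain w1 w2 w3 where "P1 = ?T w1" "P2 = ?T w2" "P3 = ?T w3"
      and u: "cmod w1 = 1" "cmod w2 = 1" "cmod w3 = 1"
      unfolding ellipse_eq_image[OF AB] by blast
    then show "t \<in> ellipse_triangle A B ` poncelet_triples q"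
      using t tt mem[OF u] by (force simp: ellipse_triangle_def)
  next
    fix t assume "t \<in> ellipse_triangle A B ` poncelet_triples q"
    then obtain w1 w2 w3 where w: "(w1, w2, w3) \<in> poncelet_triples q" "t = ellipse_triangle A B (w1, w2, w3)"
      by auto
    then show "t \<in> poncelet_family (ellipse A B) ?E"
      using mem[of w1 w2 w3] by (simp add: poncelet_triples_def ellipse_triangle_def)
  qed
qed

lemma poncelet_triplesD:
  assumes "(w1, w2, w3) \<in> poncelet_triples q"
  shows "cmod w1 = 1" "cmod w2 = 1" "cmod w3 = 1" "w1 \<noteq> w2" "w2 \<noteq> w3" "w3 \<noteq> w1"
    "w1 * w2 + w2 * w3 + w3 * w1 = of_real q"
    "cnj w1 * w1 = 1" "cnj w2 * w2 = 1" "cnj w3 * w3 = 1" "w1 \<noteq> 0" "w2 \<noteq> 0" "w3 \<noteq> 0"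
  using assms cnj_of_unit by (auto simp: poncelet_triples_def)

lemma poncelet_triples_rotate:
  "(w1, w2, w3) \<in> poncelet_triples q \<Longrightarrow> (w2, w3, w1) \<in> poncelet_triples q"
  by (auto simp: poncelet_triples_def algebra_simps)

text \<open>The conjugate of the defining equation, with \<open>cnj w = 1 / w\<close>.\<close>

lemma poncelet_sum:
  assumes "(w1, w2, w3) \<in> poncelet_triples q"
  shows "w1 + w2 + w3 = of_real q * (w1 * w2 * w3)"
proof -
  note w = poncelet_triplesD[OF assms]
  have "cnj w1 * cnj w2 + cnj w2 * cnj w3 + cnj w3 * cnj w1 = of_real q"
    using arg_cong[OF w(7), of cnj] by simp
  from this[symmetric] show ?thesis using w(8-10) by (simp only:) algebra
qed

text \<open>This is \<open>\<bar>w1 * w2 + w2 * w3 + w3 * w1\<bar>^2 = q^2\<close> multiplied out.\<close>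

lemma poncelet_sum_Re:
  assumes "(w1, w2, w3) \<in> poncelet_triples q"
  shows "Re (w2 * cnj w3) + Re (w3 * cnj w1) + Re (w1 * cnj w2) = (q\<^sup>2 - 3) / 2"
proof -
  note w = poncelet_triplesD[OF assms]
  have "cnj w1 * cnj w2 + cnj w2 * cnj w3 + cnj w3 * cnj w1 = of_real q"
    using arg_cong[OF w(7), of cnj] by simp
  with w(7) have q2: "(of_real q)\<^sup>2 = (w1 * w2 + w2 * w3 + w3 * w1) * (cnj w1 * cnj w2 + cnj w2 * cnj w3 + cnj w3 * cnj w1)"
    by (simp add: power2_eq_square)
  have "w2 * cnj w3 + cnj w2 * w3 + (w3 * cnj w1 + cnj w3 * w1) + (w1 * cnj w2 + cnj w1 * w2)
     = (of_real q)\<^sup>2 - 3"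
    unfolding q2 using w(8-10) by algebra
  from arg_cong[OF this, of Re] show ?thesis
    by (simp add: power2_eq_square algebra_simps)
qed

text \<open>The isosceles triangle with a vertex on the positive \<open>x\<close>-axis.\<close>

lemma ex_poncelet_triple:
  assumes "0 \<le> q" "q < 1"
  shows "poncelet_triples q \<noteq> {}"
proof -
  define x y where xy: "x = - (1 - q) / 2" "y = sqrt (1 - x\<^sup>2)"
  have "\<bar>x\<bar> < 1" using assms by (simp add: xy)
  then have "x\<^sup>2 < 1" by (simp add: abs_square_less_1)
  then have y: "y > 0" "x\<^sup>2 + y\<^sup>2 = 1" by (simp_all add: xy)
  have "(1, Complex x y, Complex x (- y)) \<in> poncelet_triples q"
  proof -
    have "1 + 2 * x = q" by (simp add: xy field_simps)
    then have "1 * Complex x y + Complex x y * Complex x (- y) + Complex x (- y) * 1 = of_real q"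
      using y(2) by (simp add: complex_eq_iff power2_eq_square)
    then show ?thesis using y by (simp add: poncelet_triples_def cmod_def complex_eq_iff)
  qed
  then show ?thesis by blast
qed

section \<open>Cosines of the triangles of the incircle family\<close>

text \<open>The cosine of the angle at \<open>z1\<close>, in complex notation.\<close>

definition corner_cos :: "complex \<Rightarrow> complex \<Rightarrow> complex \<Rightarrow> real" where
  "corner_cos z1 z2 z3 = Re ((z2 - z1) * cnj (z3 - z1)) / (cmod (z2 - z1) * cmod (z3 - z1))"

definition ellipse_complex :: "real \<Rightarrow> real \<Rightarrow> complex \<Rightarrow> complex" where
  "ellipse_complex A B w = Complex (A * Re w) (B * Im w)"

lemma ellipse_complex_eq:
  "ellipse_complex A B w = of_real ((A + B) / 2) * w + of_real ((A - B) / 2) * cnj w"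
  by (simp add: ellipse_complex_def complex_eq_iff field_simps)

lemma cos_interior_angle:
  "cos (interior_angle (ellipse_point A B w1) (ellipse_point A B w2) (ellipse_point A B w3)) =
     corner_cos (ellipse_complex A B w1) (ellipse_complex A B w2) (ellipse_complex A B w3)"
proof -
  have "\<bar>(x \<bullet> y) / (norm x * norm y)\<bar> \<le> 1" for x y :: "real^2"
    using Cauchy_Schwarz_ineq2[of x y] by (auto simp: abs_mult divide_le_eq)
  then have c: "cos (vector_angle x y) = (x \<bullet> y) / (norm x * norm y)" for x y :: "real^2"
    unfolding vector_angle_def by (intro cos_arccos_abs)
  let ?P = "ellipse_point A B" and ?Z = "ellipse_complex A B"
  have "(?P w - ?P v) \<bullet> (?P z - ?P v) = Re ((?Z w - ?Z v) * cnj (?Z z - ?Z v))" for v w z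
    by (simp add: ellipse_complex_def inner_vec_def sum_2) (simp add: algebra_simps)
  moreover have "norm (?P w - ?P v) = cmod (?Z w - ?Z v)" for v w
    by (simp add: ellipse_complex_def norm_vec_def L2_set_def sum_2 cmod_def)
  ultimately show ?thesis
    unfolding interior_angle_def c corner_cos_def by simp
qed

lemma cosine_triple_ellipse_triangle:
  "cosine_triple (ellipse_triangle A B (w1, w2, w3)) =
    (let z1 = ellipse_complex A B w1; z2 = ellipse_complex A B w2; z3 = ellipse_complex A B w3
     in vector [corner_cos z1 z2 z3, corner_cos z2 z3 z1, corner_cos z3 z1 z2])"
  by (simp add: cosine_triple_def ellipse_triangle_def cos_interior_angle Let_def)

text \<open>
  With these axes the vertex is proportional to \<open>w + q * cnj w\<close>, and the difference of two vertices has
  the factor \<open>w1 * w2 - q = - w3 * (w1 + w2)\<close>. As \<open>(w2^2 - w1^2) * cnj w1 * cnj w2\<close> is imaginary, the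
  side is perpendicular to \<open>w3\<close>.
\<close>

lemma incircle_chord:
  assumes "(w1, w2, w3) \<in> poncelet_triples q" and "a - b = q * (a + b)"
  shows "ellipse_complex a b w2 - ellipse_complex a b w1 =
     - of_real ((a + b) / 2) * (w2\<^sup>2 - w1\<^sup>2) * (w3 * cnj w1 * cnj w2)"
proof -
  note w = poncelet_triplesD[OF assms(1)]
  have e: "ellipse_complex a b w = of_real ((a + b) / 2) * (w + of_real q * cnj w)" for w
    unfolding ellipse_complex_eq assms(2) by (simp add: add_divide_distrib algebra_simps)
  have c: "w2 + of_real q * cnj w2 - (w1 + of_real q * cnj w1) = - (w2\<^sup>2 - w1\<^sup>2) * (w3 * cnj w1 * cnj w2)"
    unfolding w(7)[symmetric] using w(8-9) by algebra
  show ?thesis unfolding e right_diff_distrib[symmetric] c by algebra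
qed

text \<open>
  Side directions determine the angles only up to supplements; this sign selects the right ones.
  Twice the product equals \<open>(q^2 - 3) / 2 - q * Re (w1^2)\<close>, which is at most
  \<open>- (3 + q) * (1 - q) / 2\<close>.
\<close>

lemma Im_mult_Im_neg:
  assumes "(w1, w2, w3) \<in> poncelet_triples q" "0 \<le> q" "q < 1"
  shows "Im (w2 * cnj w1) * Im (w3 * cnj w1) < 0"
proof -
  note w = poncelet_triplesD[OF assms(1)]
  have "w2 * w3 * (cnj w1)\<^sup>2 = of_real q * (cnj w1)\<^sup>2 - (w2 * cnj w1 + w3 * cnj w1)"
    unfolding w(7)[symmetric] using w(8-10) by algebra
  from arg_cong[OF this, of Re]
  have 1: "Re (w2 * w3 * (cnj w1)\<^sup>2) = q * Re ((cnj w1)\<^sup>2) - (Re (w2 * cnj w1) + Re (w3 * cnj w1))"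
    by simp
  have 2: "2 * (Im (w2 * cnj w1) * Im (w3 * cnj w1)) =
      Re ((w2 * cnj w1) * cnj (w3 * cnj w1)) - Re ((w2 * cnj w1) * (w3 * cnj w1))"
    by (simp add: algebra_simps)
  have 3: "(w2 * cnj w1) * cnj (w3 * cnj w1) = w2 * cnj w3"
    unfolding complex_cnj_mult complex_cnj_cnj using w(8) by algebra
  have 4: "(w2 * cnj w1) * (w3 * cnj w1) = w2 * w3 * (cnj w1)\<^sup>2" by algebra
  have 5: "Re (w2 * cnj w1) = Re (w1 * cnj w2)" by simp
  have "\<bar>Re ((cnj w1)\<^sup>2)\<bar> \<le> 1"
    using abs_Re_le_cmod[of "(cnj w1)\<^sup>2"] w(1) by (simp add: norm_power)
  then have 6: "- q \<le> q * Re ((cnj w1)\<^sup>2)"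
    using mult_left_mono[of "-1" "Re ((cnj w1)\<^sup>2)" q] assms(2) by (simp add: abs_le_iff)
  have "2 * (Im (w2 * cnj w1) * Im (w3 * cnj w1)) = (q\<^sup>2 - 3) / 2 - q * Re ((cnj w1)\<^sup>2)"
    unfolding 2 3 4 1 using poncelet_sum_Re[OF assms(1)] 5 by linarith
  also have "\<dots> \<le> (q\<^sup>2 - 3) / 2 + q" using 6 by linarith
  also have "\<dots> = - ((3 + q) * (1 - q) / 2)" by (simp add: power2_eq_square field_simps)
  also have "\<dots> < 0" using assms by simp
  finally show ?thesis by simp
qed

lemma corner_cos_incircle:
  assumes W: "(w1, w2, w3) \<in> poncelet_triples q" and q: "0 \<le> q" "q < 1"
    and ab: "a - b = q * (a + b)" "a + b > 0"
  shows "corner_cos (ellipse_complex a b w1) (ellipse_complex a b w2) (ellipse_complex a b w3)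
     = - Re (w2 * cnj w3)"
proof -
  note w = poncelet_triplesD[OF W]
  have W2: "(w3, w1, w2) \<in> poncelet_triples q"
    using W poncelet_triples_rotate by blast
  define R where "R = (a + b) / 2"
  define m n where mn: "m = Im (w2 * cnj w1)" "n = Im (w3 * cnj w1)"
  define \<kappa> where "\<kappa> = 4 * R\<^sup>2 * (m * n)"
  have \<kappa>: "\<kappa> < 0"
    unfolding \<kappa>_def using Im_mult_Im_neg[OF W q] ab by (simp add: R_def mn mult_pos_neg)
  let ?u = "ellipse_complex a b w2 - ellipse_complex a b w1"
  let ?v = "ellipse_complex a b w3 - ellipse_complex a b w1"
  have u: "?u = - of_real R * (w2\<^sup>2 - w1\<^sup>2) * (w3 * cnj w1 * cnj w2)"
    unfolding R_def by (rule incircle_chord[OF W ab(1)])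
  have v: "?v = - of_real R * (w3\<^sup>2 - w1\<^sup>2) * (w2 * cnj w1 * cnj w3)"
  proof -
    have "- ?v = - of_real R * (w1\<^sup>2 - w3\<^sup>2) * (w2 * cnj w3 * cnj w1)"
      using incircle_chord[OF W2 ab(1)] unfolding R_def by simp
    then show ?thesis by algebra
  qed
  have k: "of_real \<kappa> = (of_real R)\<^sup>2 * (w2 * cnj w1 - cnj w2 * w1) * (cnj w3 * w1 - w3 * cnj w1)"
  proof -
    have i: "w2 * cnj w1 - cnj w2 * w1 = of_real (2 * m) * \<i>"
      "cnj w3 * w1 - w3 * cnj w1 = of_real (- 2 * n) * \<i>"
      by (simp_all add: complex_eq_iff mn)
    show ?thesis unfolding \<kappa>_def i by (simp add: algebra_simps)
  qed
  have X: "?u * cnj ?v = of_real \<kappa> * (w3 * cnj w2)"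
    unfolding u v k complex_cnj_mult complex_cnj_diff complex_cnj_power complex_cnj_minus
      complex_cnj_complex_of_real complex_cnj_cnj
    using w(8-10) by algebra
  have "cmod ?u * cmod ?v = cmod (?u * cnj ?v)"
    by (simp add: norm_mult del: complex_cnj_diff)
  also have "\<dots> = - \<kappa>" unfolding X using w \<kappa> by (simp add: norm_mult)
  finally have "corner_cos (ellipse_complex a b w1) (ellipse_complex a b w2) (ellipse_complex a b w3)
     = Re (of_real \<kappa> * (w3 * cnj w2)) / (- \<kappa>)"
    unfolding corner_cos_def X by simp
  also have "\<dots> = - Re (w2 * cnj w3)" using \<kappa> by (simp add: field_simps)
  finally show ?thesis .
qed

lemma cosine_triple_incircle:
  assumes W: "(w1, w2, w3) \<in> poncelet_triples q" and q: "0 \<le> q" "q < 1"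
    and ab: "a - b = q * (a + b)" "a + b > 0"
  shows "cosine_triple (ellipse_triangle a b (w1, w2, w3)) =
    vector [- Re (w2 * cnj w3), - Re (w3 * cnj w1), - Re (w1 * cnj w2)]"
proof -
  have W2: "(w2, w3, w1) \<in> poncelet_triples q" and W3: "(w3, w1, w2) \<in> poncelet_triples q"
    using W poncelet_triples_rotate by blast+
  show ?thesis
    unfolding cosine_triple_ellipse_triangle Let_def
    by (simp only: corner_cos_incircle[OF W q ab] corner_cos_incircle[OF W2 q ab] corner_cos_incircle[OF W3 q ab])
qed

text \<open>
  The Gram determinant of the three plane vectors \<open>w1\<close>, \<open>w2\<close>, \<open>w3\<close> vanishes; equivalently, three
  angles with sum \<open>\<pi>\<close> have cosines that satisfy this relation.
\<close>

lemma poncelet_cosine_relation: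
  fixes w1 w2 w3 :: complex
  assumes "cmod w1 = 1" "cmod w2 = 1" "cmod w3 = 1"
    and "c1 = - Re (w2 * cnj w3)" "c2 = - Re (w3 * cnj w1)" "c3 = - Re (w1 * cnj w2)"
  shows "c1\<^sup>2 + c2\<^sup>2 + c3\<^sup>2 + 2 * c1 * c2 * c3 = 1"
proof -
  have "(Re w1)\<^sup>2 + (Im w1)\<^sup>2 = 1" "(Re w2)\<^sup>2 + (Im w2)\<^sup>2 = 1" "(Re w3)\<^sup>2 + (Im w3)\<^sup>2 = 1"
    using assms(1-3) by (simp_all add: cmod_def)
  moreover have "c1 = - (Re w2 * Re w3 + Im w2 * Im w3)" "c2 = - (Re w3 * Re w1 + Im w3 * Im w1)"
     "c3 = - (Re w1 * Re w2 + Im w1 * Im w2)"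
    using assms(4-6) by simp_all
  ultimately show ?thesis by algebra
qed

text \<open>
  The numbers \<open>g1\<close>, \<open>g2\<close> below play the parts of \<open>w2 * cnj w3\<close> and \<open>w3 * cnj w1\<close>. The third quotient must be
  \<open>cnj (g1 * g2)\<close>, so its real part is right iff \<open>s1 * s2 = c1 * c2 + c3\<close>. The relation gives the squares
  of both sides, and the right-hand side is positive because the sum of the cosines exceeds 1.
\<close>

lemma ex_poncelet_triple_with_cosines:
  assumes q: "0 \<le> q" "q < 1" and sum: "c1 + c2 + c3 = (3 - q\<^sup>2) / 2"
    and rel: "c1\<^sup>2 + c2\<^sup>2 + c3\<^sup>2 + 2 * c1 * c2 * c3 = 1"
    and bd: "\<bar>c1\<bar> \<le> 1" "\<bar>c2\<bar> \<le> 1" "\<bar>c3\<bar> \<le> 1"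
  shows "\<exists>w1 w2 w3. (w1, w2, w3) \<in> poncelet_triples q \<and>
     c1 = - Re (w2 * cnj w3) \<and> c2 = - Re (w3 * cnj w1) \<and> c3 = - Re (w1 * cnj w2)"
proof -
  have q1: "q\<^sup>2 < 1" using q by (simp add: power_less_one_iff abs_square_less_1)
  define s1 s2 where s: "s1 = sqrt (1 - c1\<^sup>2)" "s2 = sqrt (1 - c2\<^sup>2)"
  have s1: "s1\<^sup>2 = 1 - c1\<^sup>2" and s2: "s2\<^sup>2 = 1 - c2\<^sup>2"
    using bd by (simp_all add: s abs_square_le_1)
  have "c1 * c2 + c3 \<ge> 0"
  proof -
    have "c1 * c2 + c3 = (1 - q\<^sup>2) / 2 + (1 - c1) * (1 - c2)"
      using sum by (simp add: field_simps)
    moreover have "(1 - c1) * (1 - c2) \<ge> 0" using bd by (intro mult_nonneg_nonneg) auto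
    ultimately show ?thesis using q1 by simp
  qed
  moreover have "(s1 * s2)\<^sup>2 = (c1 * c2 + c3)\<^sup>2"
    using s1 s2 rel by algebra
  moreover have "s1 * s2 \<ge> 0" using bd by (simp add: s abs_square_le_1)
  ultimately have s12: "s1 * s2 = c1 * c2 + c3" by (metis power2_eq_iff_nonneg)
  define g1 g2 where g: "g1 = Complex (- c1) s1" "g2 = Complex (- c2) s2"
  have gu: "cmod g1 = 1" "cmod g2 = 1" using s1 s2 by (simp_all add: g cmod_def)
  have gg: "Re (g1 * g2) = - c3" using s12 by (simp add: g)
  have gR: "Re g1 = - c1" "Re g2 = - c2" by (simp_all add: g)
  define e where "e = cnj g2 * g1 + g1 + cnj g2"
  have e: "cmod e = q"
  proof -
    have "e * cnj e = 3 + (g1 + cnj g1) + (g2 + cnj g2) + (g1 * g2 + cnj (g1 * g2))"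
      unfolding e_def complex_cnj_mult complex_cnj_add complex_cnj_cnj
      using cnj_of_unit(1)[OF gu(1)] cnj_of_unit(1)[OF gu(2)] by algebra
    also have "\<dots> = of_real (3 + 2 * Re g1 + 2 * Re g2 + 2 * Re (g1 * g2))"
      by (simp only: complex_add_cnj of_real_add) simp
    also have "3 + 2 * Re g1 + 2 * Re g2 + 2 * Re (g1 * g2) = q\<^sup>2"
      unfolding gg gR using sum by (simp add: field_simps)
    finally have "(cmod e)\<^sup>2 = q\<^sup>2" by (metis complex_norm_square of_real_eq_iff)
    then show ?thesis using q by simp
  qed
  \<comment> \<open>Multiplying the triple by \<open>l\<close> keeps the quotients and multiplies \<open>e\<close> by \<open>l^2\<close>. For \<open>q = 0\<close> any
     unit \<open>l\<close> does.\<close>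
  obtain l where l: "cmod l = 1" "l\<^sup>2 * e = of_real q"
  proof (cases "q = 0")
    case True
    then show ?thesis using that[of 1] e by simp
  next
    case False
    have "(cmod (csqrt (of_real q / e)))\<^sup>2 = 1"
      using e False q by (simp flip: norm_power add: norm_divide)
    then have "cmod (csqrt (of_real q / e)) = 1"
      using power2_eq_1_iff norm_ge_zero by (smt (verit))
    moreover have "(csqrt (of_real q / e))\<^sup>2 * e = of_real q" using e False by auto
    ultimately show ?thesis by (rule that)
  qed
  have lc: "l * cnj l = 1" using cnj_of_unit[OF l(1)] by (simp add: mult.commute)
  let ?w1 = "l * cnj g2" and ?w2 = "l * g1" and ?w3 = l
  have u: "cmod ?w1 = 1" "cmod ?w2 = 1" "cmod ?w3 = 1" using l gu by (simp_all add: norm_mult)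
  have p: "?w2 * cnj ?w3 = g1" "?w3 * cnj ?w1 = g2" "?w1 * cnj ?w2 = cnj (g1 * g2)"
    using lc by (auto simp: algebra_simps)
  have c: "c1 = - Re (?w2 * cnj ?w3)" "c2 = - Re (?w3 * cnj ?w1)" "c3 = - Re (?w1 * cnj ?w2)"
    unfolding p complex_cnj(1) using gR gg by simp_all
  \<comment> \<open>Two equal vertices would mean a cosine \<open>-1\<close>, but then the sum is at most 1.\<close>
  have "c1 \<noteq> -1" "c2 \<noteq> -1" "c3 \<noteq> -1" using sum bd q1 by (auto simp: field_simps)
  moreover have "x \<noteq> y" if "cmod y = 1" "- Re (x * cnj y) \<noteq> -1" for x y
  proof
    assume "x = y"
    then have "x * cnj y = 1" using cnj_of_unit(1)[OF that(1)] by (simp add: mult.commute)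
    then have "Re (x * cnj y) = 1" by (simp only: one_complex.sel)
    with that(2) show False by linarith
  qed
  ultimately have "?w2 \<noteq> ?w3" "?w3 \<noteq> ?w1" "?w1 \<noteq> ?w2"
    unfolding c using u by blast+
  moreover have "?w1 * ?w2 + ?w2 * ?w3 + ?w3 * ?w1 = of_real q"
    unfolding l(2)[symmetric] e_def by algebra
  ultimately show ?thesis using u c unfolding poncelet_triples_def by blast
qed

section \<open>The cubic\<close>

text \<open>The arguments of \<open>Delta\<close> are the coordinates of the point \<open>(x, y, z)\<close> in its plane of constant sum.\<close>

lemma Delta_eq_cosine_relation:
  "Delta (x + y + z) ((y - x) / sqrt 2) ((x + y - 2 * z) / sqrt 6)
     = 27 * (x\<^sup>2 + y\<^sup>2 + z\<^sup>2 + 2 * x * y * z - 1)"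
proof -
  define u where "u = (y - x) / sqrt 2"
  define v where "v = (x + y - 2 * z) / sqrt 6"
  have u: "u\<^sup>2 = (y - x)\<^sup>2 / 2" by (simp add: u_def power_divide)
  have v: "v\<^sup>2 = (x + y - 2 * z)\<^sup>2 / 6" by (simp add: v_def power_divide)
  have sv: "sqrt 6 * v = x + y - 2 * z" by (simp add: v_def)
  have "Delta (x + y + z) u v = 3 * (3 * u\<^sup>2 - v\<^sup>2) * (sqrt 6 * v) - 9 * (x + y + z - 3) * (u\<^sup>2 + v\<^sup>2)
     + (2 * (x + y + z) - 3) * (x + y + z + 3)\<^sup>2"
    by (simp add: Delta_def)
  also have "\<dots> = 27 * (x\<^sup>2 + y\<^sup>2 + z\<^sup>2 + 2 * x * y * z - 1)"
    unfolding u v sv by (simp add: field_simps power2_eq_square)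
  finally show ?thesis by (simp add: u_def v_def)
qed

lemma plane_point_nth:
  "plane_point k u v $ 1 = k / 3 - u / sqrt 2 + v / sqrt 6"
  "plane_point k u v $ 2 = k / 3 + u / sqrt 2 + v / sqrt 6"
  "plane_point k u v $ 3 = k / 3 - 2 * (v / sqrt 6)"
  by (simp_all add: plane_point_def)

text \<open>
  The cubic is a plane section of the cubic surface on which the cosines of any three angles with
  sum \<open>\<pi>\<close> lie.
\<close>

lemma Delta_curve_iff:
  "c \<in> Delta_curve k \<longleftrightarrow> c$1 + c$2 + c$3 = k \<and>
     (c$1)\<^sup>2 + (c$2)\<^sup>2 + (c$3)\<^sup>2 + 2 * c$1 * c$2 * c$3 = 1"
proof
  assume "c \<in> Delta_curve k"
  then obtain u v where c: "c = plane_point k u v" and D: "Delta k u v = 0"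
    by (auto simp: Delta_curve_def)
  have s: "c$1 + c$2 + c$3 = k" by (simp add: c plane_point_nth)
  have "(c$2 - c$1) / sqrt 2 = u"
    by (simp add: c plane_point_nth field_simps)
  moreover have "(c$1 + c$2 - 2 * c$3) / sqrt 6 = v"
  proof -
    have "c$1 + c$2 - 2 * c$3 = 6 * (v / sqrt 6)" by (simp add: c plane_point_nth)
    then show ?thesis by simp
  qed
  ultimately show "c$1 + c$2 + c$3 = k \<and>
     (c$1)\<^sup>2 + (c$2)\<^sup>2 + (c$3)\<^sup>2 + 2 * c$1 * c$2 * c$3 = 1"
    using s D Delta_eq_cosine_relation[of "c$1" "c$2" "c$3"] by simp
next
  assume a: "c$1 + c$2 + c$3 = k \<and>
     (c$1)\<^sup>2 + (c$2)\<^sup>2 + (c$3)\<^sup>2 + 2 * c$1 * c$2 * c$3 = 1"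
  let ?u = "(c$2 - c$1) / sqrt 2" and ?v = "(c$1 + c$2 - 2 * c$3) / sqrt 6"
  have "Delta k ?u ?v = 0" using a Delta_eq_cosine_relation[of "c$1" "c$2" "c$3"] by simp
  moreover have "c = plane_point k ?u ?v"
    using a by (auto simp: vec_eq_iff forall_3 plane_point_nth field_simps)
  ultimately show "c \<in> Delta_curve k" by (auto simp: Delta_curve_def)
qed

definition Delta_coeff :: "real \<Rightarrow> nat \<Rightarrow> nat \<Rightarrow> real" where
  "Delta_coeff k i j =
     (if (i, j) = (2, 1) then 9 * sqrt 6
      else if (i, j) = (0, 3) then - 3 * sqrt 6
      else if (i, j) = (2, 0) \<or> (i, j) = (0, 2) then - 9 * (k - 3)
      else if (i, j) = (0, 0) then (2 * k - 3) * (k + 3)\<^sup>2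
      else 0)"

lemma Delta_eq_cubic_poly: "Delta k u v = cubic_poly (Delta_coeff k) u v"
  by (simp add: cubic_poly_def Delta_coeff_def Delta_def eval_nat_numeral algebra_simps)

lemma leading_form_Delta:
  "cubic_leading_form (Delta_coeff k) u v = 3 * sqrt 6 * v * (sqrt 3 * u - v) * (sqrt 3 * u + v)"
proof -
  have "cubic_leading_form (Delta_coeff k) u v = 3 * sqrt 6 * v * (3 * u\<^sup>2 - v\<^sup>2)"
    by (simp add: cubic_leading_form_def Delta_coeff_def eval_nat_numeral algebra_simps)
  also have "3 * u\<^sup>2 - v\<^sup>2 = (sqrt 3 * u - v) * (sqrt 3 * u + v)"
    by (simp add: algebra_simps power2_eq_square)
  finally show ?thesis by (simp add: mult.assoc)
qed

lemma span_singleton_eq_if_cross_zero: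
  fixes d e :: "real^2"
  assumes "d \<noteq> 0" "e \<noteq> 0" "d$1 * e$2 = d$2 * e$1"
  shows "span {d} = span {e}"
proof -
  have *: "d \<in> span {e}" if "e \<noteq> 0" "d$1 * e$2 = d$2 * e$1" for d e :: "real^2"
  proof (cases "e$1 = 0")
    case True
    then have "e$2 \<noteq> 0" using that(1) by (auto simp: vec_eq_iff forall_2)
    then have "d = (d$2 / e$2) *\<^sub>R e" using True that(2) by (auto simp: vec_eq_iff forall_2)
    then show ?thesis by (metis span_base span_scale singletonI)
  next
    case False
    then have "d = (d$1 / e$1) *\<^sub>R e" using that(2) by (auto simp: vec_eq_iff forall_2 field_simps)
    then show ?thesis by (metis span_base span_scale singletonI)
  qed
  show ?thesis
    using *[of e d] *[of d e] assms by (simp add: span_eq mult.commute)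
qed

lemma asymptotic_directions_Delta:
  "asymptotic_directions (Delta_coeff k) =
     {span {vector [1, 0]}, span {vector [1, sqrt 3]}, span {vector [-1, sqrt 3]}}"
    (is "?L = {span {?a}, span {?b}, span {?c}}")
proof (rule equalityI; rule subsetI)
  have nz: "?a \<noteq> 0" "?b \<noteq> 0" "?c \<noteq> 0" by (simp_all add: vec_eq_iff forall_2)
  fix L assume "L \<in> ?L"
  then obtain d :: "real^2" where d: "d \<noteq> 0" "L = span {d}"
    and "3 * sqrt 6 * d$2 * (sqrt 3 * d$1 - d$2) * (sqrt 3 * d$1 + d$2) = 0"
    by (auto simp: asymptotic_directions_def leading_form_Delta)
  then consider "d$2 = 0" | "d$2 = sqrt 3 * d$1" | "d$2 = - sqrt 3 * d$1" by force
  then show "L \<in> {span {?a}, span {?b}, span {?c}}"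
  proof cases
    case 1 then show ?thesis using d nz span_singleton_eq_if_cross_zero[of d ?a] by simp
  next
    case 2 then show ?thesis using d nz span_singleton_eq_if_cross_zero[of d ?b] by simp
  next
    case 3 then show ?thesis using d nz span_singleton_eq_if_cross_zero[of d ?c] by simp
  qed
next
  have nz: "?a \<noteq> 0" "?b \<noteq> 0" "?c \<noteq> 0" by (simp_all add: vec_eq_iff forall_2)
  fix L assume "L \<in> {span {?a}, span {?b}, span {?c}}"
  then obtain d where "L = span {d}" "d = ?a \<or> d = ?b \<or> d = ?c" by auto
  then show "L \<in> ?L" using nz
    unfolding asymptotic_directions_def leading_form_Delta by auto
qed

lemma cos_pi_3_vector_angle:
  assumes "x \<bullet> y / (norm x * norm y) = 1 / 2"
  shows "vector_angle x y = pi / 3"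
  unfolding vector_angle_def assms using arccos_cos[of "pi / 3"] by (simp add: cos_60)

text \<open>
  The generators \<open>?b\<close> and \<open>?c\<close> enclose 60 degrees, and so do \<open>?a\<close> and \<open>?b\<close>. From \<open>?a\<close> to \<open>?c\<close> the angle
  is obtuse, so the opposite vector has to represent the third line there.
\<close>

lemma equilateral_cubic_Delta: "equilateral_cubic (Delta k)"
proof -
  let ?a = "vector [1, 0] :: real^2" and ?b = "vector [1, sqrt 3] :: real^2"
    and ?c = "vector [-1, sqrt 3] :: real^2"
  have norms: "norm ?a = 1" "norm ?b = 2" "norm ?c = 2" "norm (- ?c) = 2"
    by (simp_all add: norm_vec_def L2_set_def sum_2)
  have angles: "vector_angle ?a ?b = pi / 3" "vector_angle ?b ?a = pi / 3"
     "vector_angle ?b ?c = pi / 3" "vector_angle ?c ?b = pi / 3"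
     "vector_angle ?a (- ?c) = pi / 3" "vector_angle (- ?c) ?a = pi / 3"
    by (rule cos_pi_3_vector_angle, simp add: norms inner_vec_def sum_2)+
  have nz: "?a \<noteq> 0" "?b \<noteq> 0" "?c \<noteq> 0" "- ?c \<noteq> 0" by (simp_all add: vec_eq_iff forall_2)
  have sc: "span {- ?c} = span {?c}"
    by (rule span_singleton_eq_if_cross_zero) (use nz in auto)
  have *: "line_angle (span {x}) (span {y}) (pi / 3)"
    if "vector_angle x y = pi / 3" "x \<noteq> 0" "y \<noteq> 0" for x y
    unfolding line_angle_def using that by (intro exI[of _ x] exI[of _ y]) simp
  have la: "line_angle (span {?a}) (span {?b}) (pi / 3)" "line_angle (span {?b}) (span {?a}) (pi / 3)"
    "line_angle (span {?b}) (span {?c}) (pi / 3)" "line_angle (span {?c}) (span {?b}) (pi / 3)"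
    "line_angle (span {?a}) (span {?c}) (pi / 3)" "line_angle (span {?c}) (span {?a}) (pi / 3)"
    using *[OF angles(1)] *[OF angles(2)] *[OF angles(3)] *[OF angles(4)] *[OF angles(5)] *[OF angles(6)] nz sc
    by simp_all
  have ne: "span {x} \<noteq> span {y}" if "x$1 * y$2 \<noteq> x$2 * y$1" for x y :: "real^2"
  proof
    assume "span {x} = span {y}"
    then have "x \<in> span {y}" using span_base[of x "{x}"] by simp
    then obtain t where "x = t *\<^sub>R y" by (auto simp: span_singleton)
    then show False using that by simp
  qed
  have "card (asymptotic_directions (Delta_coeff k)) = 3"
    unfolding asymptotic_directions_Delta
    using ne[of ?a ?b] ne[of ?b ?c] ne[of ?a ?c] by simp
  moreover have "\<forall>L \<in> asymptotic_directions (Delta_coeff k). \<forall>M \<in> asymptotic_directions (Delta_coeff k).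
          L \<noteq> M \<longrightarrow> line_angle L M (pi / 3)"
    unfolding asymptotic_directions_Delta using la by auto
  ultimately show ?thesis
    unfolding equilateral_cubic_def using Delta_eq_cubic_poly by blast
qed

lemma cosine_locus_incircle:
  assumes q: "0 \<le> q" "q < 1" and ab: "a - b = q * (a + b)" "a + b > 0"
  shows "cosine_locus (ellipse_triangle a b ` poncelet_triples q)
       = Delta_curve ((3 - q\<^sup>2) / 2) \<inter> {c. \<forall>i. \<bar>c $ i\<bar> \<le> 1}"
proof (rule set_eqI, rule iffI)
  fix c assume "c \<in> cosine_locus (ellipse_triangle a b ` poncelet_triples q)"
  then obtain w1 w2 w3 where W: "(w1, w2, w3) \<in> poncelet_triples q"
    and "c = cosine_triple (ellipse_triangle a b (w1, w2, w3))" by (auto simp: cosine_locus_def)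
  then have c: "c = vector [- Re (w2 * cnj w3), - Re (w3 * cnj w1), - Re (w1 * cnj w2)]"
    using cosine_triple_incircle[OF W q ab] by simp
  then have cs: "c$1 = - Re (w2 * cnj w3)" "c$2 = - Re (w3 * cnj w1)" "c$3 = - Re (w1 * cnj w2)"
    by simp_all
  note w = poncelet_triplesD[OF W]
  have "\<bar>Re (z * cnj z')\<bar> \<le> 1" if "cmod z = 1" "cmod z' = 1" for z z'
    using abs_Re_le_cmod[of "z * cnj z'"] that by (simp add: norm_mult)
  then have "\<forall>i. \<bar>c $ i\<bar> \<le> 1" unfolding forall_3 cs abs_minus_cancel using w by blast
  moreover have "c$1 + c$2 + c$3 = (3 - q\<^sup>2) / 2"
  proof -
    have "(3 - q\<^sup>2) / 2 = - ((q\<^sup>2 - 3) / 2)" by (simp only: minus_divide_left minus_diff_eq)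
    then show ?thesis unfolding cs poncelet_sum_Re[OF W, symmetric] by (simp only: minus_add_distrib)
  qed
  moreover have "(c$1)\<^sup>2 + (c$2)\<^sup>2 + (c$3)\<^sup>2 + 2 * c$1 * c$2 * c$3 = 1"
    by (rule poncelet_cosine_relation[OF w(1-3) cs])
  ultimately show "c \<in> Delta_curve ((3 - q\<^sup>2) / 2) \<inter> {c. \<forall>i. \<bar>c $ i\<bar> \<le> 1}"
    by (simp add: Delta_curve_iff)
next
  fix c assume "c \<in> Delta_curve ((3 - q\<^sup>2) / 2) \<inter> {c. \<forall>i. \<bar>c $ i\<bar> \<le> 1}"
  then have "c$1 + c$2 + c$3 = (3 - q\<^sup>2) / 2" "(c$1)\<^sup>2 + (c$2)\<^sup>2 + (c$3)\<^sup>2 + 2 * c$1 * c$2 * c$3 = 1"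
    "\<bar>c$1\<bar> \<le> 1" "\<bar>c$2\<bar> \<le> 1" "\<bar>c$3\<bar> \<le> 1"
    by (auto simp: Delta_curve_iff)
  from ex_poncelet_triple_with_cosines[OF q this] obtain w1 w2 w3
    where W: "(w1, w2, w3) \<in> poncelet_triples q"
    and c: "c$1 = - Re (w2 * cnj w3)" "c$2 = - Re (w3 * cnj w1)" "c$3 = - Re (w1 * cnj w2)" by blast
  have "cosine_triple (ellipse_triangle a b (w1, w2, w3)) = c"
    unfolding cosine_triple_incircle[OF W q ab] vec_eq_iff forall_3 using c by simp
  then show "c \<in> cosine_locus (ellipse_triangle a b ` poncelet_triples q)"
    unfolding cosine_locus_def using W by (metis imageI)
qed

section \<open>Similarity of the confocal and the incircle triangles\<close>

text \<open>
  For the ellipse with semi-axes \<open>A\<close>, \<open>B\<close> and \<open>d = (B - A) / (A + B)\<close>, a chord with parameters \<open>y\<close>, \<open>z\<close> is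
  parallel to the unit vector \<open>w\<close> iff \<open>y * z\<close> is this function of \<open>w^2\<close>: if \<open>y * z = exp (2 * \<i> * \<sigma>)\<close>, the
  chord has the direction \<open>(- A * sin \<sigma>, B * cos \<sigma>)\<close>. Up to sign the function is an automorphism of the
  unit disc, hence preserves the unit circle.
\<close>

definition parallel_chord_product :: "real \<Rightarrow> complex \<Rightarrow> complex" where
  "parallel_chord_product d x = - (x + of_real d) / (1 + of_real d * x)"

lemma cmod_parallel_chord_product:
  assumes "cmod x = 1" "\<bar>d\<bar> < 1"
  shows "cmod (parallel_chord_product d x) = 1"
proof -
  have "x + of_real d = x * cnj (1 + of_real d * x)"
    using cnj_of_unit(1)[OF assms(1)] by (simp add: algebra_simps)
  then have c: "cmod (x + of_real d) = cmod (1 + of_real d * x)"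
    by (metis assms(1) complex_mod_cnj mult_1 norm_mult)
  show ?thesis
    unfolding parallel_chord_product_def norm_divide norm_minus_cancel c
    using one_plus_mult_unit_nonzero[OF assms] by simp
qed

lemma parallel_chord_product_inj:
  assumes "cmod x = 1" "cmod y = 1" "\<bar>d\<bar> < 1" "parallel_chord_product d x = parallel_chord_product d y"
  shows "x = y"
proof -
  have n: "1 + of_real d * x \<noteq> 0" "1 + of_real d * y \<noteq> 0"
    using one_plus_mult_unit_nonzero assms by blast+
  have "- (x + of_real d) * (1 + of_real d * y) = - (y + of_real d) * (1 + of_real d * x)"
    using assms(4) unfolding parallel_chord_product_def frac_eq_eq[OF n] .
  then have "(x - y) * (1 - (of_real d)\<^sup>2) = 0" by algebra
  moreover have "1 - (of_real d :: complex)\<^sup>2 \<noteq> 0"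
    using assms(3) by (simp flip: of_real_power add: abs_square_eq_1 power2_eq_1_iff)
  ultimately show ?thesis by simp
qed

text \<open>
  The sides of the triangle with parameters \<open>z\<close> are parallel to \<open>w1\<close>, \<open>w2\<close>, \<open>w3\<close>, hence perpendicular
  to the corresponding sides of the incircle triangle with parameters \<open>w\<close>.
\<close>

definition perpendicular_sides :: "real \<Rightarrow> complex \<times> complex \<times> complex \<Rightarrow> complex \<times> complex \<times> complex \<Rightarrow> bool" where
  "perpendicular_sides d = (\<lambda>(w1, w2, w3) (z1, z2, z3).
     z2 * z3 = parallel_chord_product d (w1\<^sup>2) \<and> z3 * z1 = parallel_chord_product d (w2\<^sup>2) \<and> z1 * z2 = parallel_chord_product d (w3\<^sup>2))"

text \<open>
  In a Poncelet triple, too, the product of two parameters is a Moebius function of the square of the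
  third.
\<close>

lemma poncelet_opposite_product:
  assumes "(w1, w2, w3) \<in> poncelet_triples q"
  shows "w2 * w3 * (1 + of_real q * w1\<^sup>2) = w1\<^sup>2 + of_real q"
proof -
  have "(w1 + w2 + w3) * w1 = of_real q * (w1 * w2 * w3) * w1"
    using poncelet_sum[OF assms] by simp
  moreover have "w1 * w2 + w2 * w3 + w3 * w1 = of_real q"
    using poncelet_triplesD[OF assms] by simp
  ultimately show ?thesis by algebra
qed

lemma poncelet_square_neq:
  assumes "(w1, w2, w3) \<in> poncelet_triples q" "0 \<le> q" "q < 1"
  shows "w1\<^sup>2 \<noteq> w2\<^sup>2"
proof
  note w = poncelet_triplesD[OF assms(1)]
  assume "w1\<^sup>2 = w2\<^sup>2"
  then have "w1 = - w2" using w(4) by (simp add: power2_eq_iff)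
  then have "of_real q = - (w2\<^sup>2)" using w(7) by algebra
  then have "cmod (of_real q) = 1" using w(2) by (simp add: norm_power)
  then show False using assms(2,3) by simp
qed

text \<open>
  The sum is a rational function of \<open>P = (w1 * w2 * w3)^2\<close>, because the symmetric functions of the squares
  of the \<open>w\<close> are linear in \<open>P\<close>. The last assumption is the one under which it is constant:
  the expression \<open>N + Q * M\<close> below is divisible by the difference of its two sides.
\<close>

lemma sum_parallel_chord_product:
  fixes q d :: real
  assumes W: "(w1, w2, w3) \<in> poncelet_triples q" and d: "\<bar>d\<bar> < 1"
    and qd: "q * d\<^sup>2 + q = (3 - q\<^sup>2) * d"
  shows "parallel_chord_product d (w1\<^sup>2) + parallel_chord_product d (w2\<^sup>2) + parallel_chord_product d (w3\<^sup>2) = of_real q"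
proof -
  note w = poncelet_triplesD[OF W]
  define Q D :: complex where QD: "Q = of_real q" "D = of_real d"
  define x1 x2 x3 where x: "x1 = w1\<^sup>2" "x2 = w2\<^sup>2" "x3 = w3\<^sup>2"
  have r: "Q * D\<^sup>2 + Q = (3 - Q\<^sup>2) * D"
    using arg_cong[OF qd, of complex_of_real] by (simp add: QD)
  have e1: "w1 + w2 + w3 = Q * (w1 * w2 * w3)" and e2: "w1 * w2 + w2 * w3 + w3 * w1 = Q"
    using poncelet_sum[OF W] w(7) by (simp_all add: QD)
  define P where "P = (w1 * w2 * w3)\<^sup>2"
  have X1: "x1 + x2 + x3 = Q\<^sup>2 * P - 2 * Q"
  proof -
    have "x1 + x2 + x3 = (w1 + w2 + w3)\<^sup>2 - 2 * (w1 * w2 + w2 * w3 + w3 * w1)" unfolding x by algebra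
    then show ?thesis unfolding e1 e2 P_def by (simp add: power_mult_distrib)
  qed
  have X2: "x1 * x2 + x2 * x3 + x3 * x1 = Q\<^sup>2 - 2 * Q * P"
  proof -
    have "x1 * x2 + x2 * x3 + x3 * x1 = (w1 * w2 + w2 * w3 + w3 * w1)\<^sup>2 - 2 * (w1 * w2 * w3) * (w1 + w2 + w3)"
      unfolding x by algebra
    then show ?thesis unfolding e1 e2 P_def by (simp add: power2_eq_square)
  qed
  have X3: "x1 * x2 * x3 = P" unfolding x P_def by algebra
  have n: "1 + D * x1 \<noteq> 0" "1 + D * x2 \<noteq> 0" "1 + D * x3 \<noteq> 0"
    unfolding QD x using one_plus_mult_unit_nonzero[OF _ d] w by (simp_all add: norm_power)
  define N where "N = (x1 + D) * (1 + D * x2) * (1 + D * x3) + (x2 + D) * (1 + D * x1) * (1 + D * x3)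
        + (x3 + D) * (1 + D * x1) * (1 + D * x2)"
  define M where "M = (1 + D * x1) * (1 + D * x2) * (1 + D * x3)"
  have "N = (x1 + x2 + x3) * (1 + 2 * D\<^sup>2) + (x1 * x2 + x2 * x3 + x3 * x1) * (2 * D + D^3)
       + 3 * D\<^sup>2 * (x1 * x2 * x3) + 3 * D"
    unfolding N_def by algebra
  moreover have "M = 1 + D * (x1 + x2 + x3) + D\<^sup>2 * (x1 * x2 + x2 * x3 + x3 * x1) + D^3 * (x1 * x2 * x3)"
    unfolding M_def by algebra
  ultimately have "N + Q * M = (Q * D\<^sup>2 + Q - (3 - Q\<^sup>2) * D) * ((Q * D - 1) + (Q - D) * P)"
    unfolding X1 X2 X3 by algebra
  then have NM: "N + Q * M = 0" using r by simp
  have "parallel_chord_product d (w1\<^sup>2) + parallel_chord_product d (w2\<^sup>2) + parallel_chord_product d (w3\<^sup>2) = - N / M"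
    using n unfolding parallel_chord_product_def QD[symmetric] x[symmetric] N_def M_def
    by (simp add: divide_simps) algebra
  also have "- N / M = Q"
  proof -
    have "M \<noteq> 0" using n by (simp add: M_def)
    moreover have "- N = Q * M" using NM by algebra
    ultimately show ?thesis by simp
  qed
  finally show ?thesis by (simp add: QD)
qed

text \<open>
  The products \<open>v1\<close>, \<open>v2\<close>, \<open>v3\<close> of pairs determine the triple up to a common sign: \<open>p\<close> has to be
  the product of all three numbers, whose square is \<open>v1 * v2 * v3\<close>.
\<close>

lemma ex_perpendicular_sides:
  assumes W: "(w1, w2, w3) \<in> poncelet_triples q" and q: "0 \<le> q" "q < 1" and d: "\<bar>d\<bar> < 1"
    and qd: "q * d\<^sup>2 + q = (3 - q\<^sup>2) * d"
  shows "\<exists>z \<in> poncelet_triples q. perpendicular_sides d (w1, w2, w3) z"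
proof -
  note w = poncelet_triplesD[OF W]
  have W2: "(w2, w3, w1) \<in> poncelet_triples q" and W3: "(w3, w1, w2) \<in> poncelet_triples q"
    using W poncelet_triples_rotate by blast+
  define v1 v2 v3 where v: "v1 = parallel_chord_product d (w1\<^sup>2)" "v2 = parallel_chord_product d (w2\<^sup>2)" "v3 = parallel_chord_product d (w3\<^sup>2)"
  have u: "cmod v1 = 1" "cmod v2 = 1" "cmod v3 = 1"
    unfolding v using cmod_parallel_chord_product[OF _ d] w by (simp_all add: norm_power)
  have ne: "v1 \<noteq> v2" "v2 \<noteq> v3" "v3 \<noteq> v1"
    unfolding v using parallel_chord_product_inj[OF _ _ d] w
      poncelet_square_neq[OF W q] poncelet_square_neq[OF W2 q] poncelet_square_neq[OF W3 q]
    by (metis norm_power power_one)+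
  have s: "v1 + v2 + v3 = of_real q" unfolding v by (rule sum_parallel_chord_product[OF W d qd])
  define p where "p = csqrt (v1 * v2 * v3)"
  have p2: "p\<^sup>2 = v1 * v2 * v3" by (simp add: p_def)
  have "(cmod p)\<^sup>2 = 1" using u by (simp flip: norm_power add: p2 norm_mult)
  then have pu: "cmod p = 1" using power2_eq_1_iff norm_ge_zero by (smt (verit))
  have nz: "v1 \<noteq> 0" "v2 \<noteq> 0" "v3 \<noteq> 0" "p \<noteq> 0" using u pu by auto
  define z1 z2 z3 where z: "z1 = p / v1" "z2 = p / v2" "z3 = p / v3"
  have pr: "z2 * z3 = v1" "z3 * z1 = v2" "z1 * z2 = v3"
    using nz p2 by (simp_all add: z field_simps power2_eq_square)
  have "z1 * z2 + z2 * z3 + z3 * z1 = of_real q" unfolding pr s[symmetric] by (simp add: algebra_simps)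
  moreover have "cmod z1 = 1" "cmod z2 = 1" "cmod z3 = 1" using u pu by (simp_all add: z norm_divide)
  moreover have "z1 \<noteq> z2" "z2 \<noteq> z3" "z3 \<noteq> z1" using ne nz by (simp_all add: z)
  ultimately have "(z1, z2, z3) \<in> poncelet_triples q" by (simp add: poncelet_triples_def)
  then show ?thesis using pr by (auto simp: perpendicular_sides_def v intro!: bexI[of _ "(z1, z2, z3)"])
qed

text \<open>
  By \<open>poncelet_opposite_product\<close> the squares \<open>x = w1^2\<close> and \<open>y = z1^2\<close> satisfy
  \<open>\<psi> y = \<phi> x\<close> for two Moebius maps, with \<open>\<phi>\<close> the map \<open>parallel_chord_product d\<close> and \<open>\<psi>\<close> the map \<open>x \<mapsto> (x + q) / (1 + q * x)\<close>.
  The matrix of the composition of \<open>\<phi>\<close> with the inverse of \<open>\<psi>\<close> has trace 0, so the composition is an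
  involution and \<open>\<psi> x = \<phi> y\<close> follows.
\<close>

lemma perpendicular_sides_sym:
  assumes W: "(w1, w2, w3) \<in> poncelet_triples q" and Z: "(z1, z2, z3) \<in> poncelet_triples q"
    and q: "0 \<le> q" "q < 1" and d: "\<bar>d\<bar> < 1"
    and rel: "perpendicular_sides d (w1, w2, w3) (z1, z2, z3)"
  shows "perpendicular_sides d (z1, z2, z3) (w1, w2, w3)"
proof -
  have *: "w2 * w3 = parallel_chord_product d (z1\<^sup>2)"
    if W: "(w1, w2, w3) \<in> poncelet_triples q" and Z: "(z1, z2, z3) \<in> poncelet_triples q"
      and r: "z2 * z3 = parallel_chord_product d (w1\<^sup>2)" for w1 w2 w3 z1 z2 z3
  proof -
    note w = poncelet_triplesD[OF W] and z = poncelet_triplesD[OF Z]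
    define Q D :: complex where QD: "Q = of_real q" "D = of_real d"
    define x y V U where xy: "x = w1\<^sup>2" "y = z1\<^sup>2" "V = w2 * w3" "U = z2 * z3"
    have n: "1 + D * x \<noteq> 0" "1 + D * y \<noteq> 0" "1 + Q * x \<noteq> 0" "1 + Q * y \<noteq> 0"
      unfolding QD xy using one_plus_mult_unit_nonzero[of _ d] one_plus_mult_unit_nonzero[of _ q] w z d q
      by (simp_all add: norm_power)
    have V: "V * (1 + Q * x) = x + Q" and U: "U * (1 + Q * y) = y + Q"
      using poncelet_opposite_product[OF W] poncelet_opposite_product[OF Z] by (simp_all add: QD xy)
    have "U * (1 + D * x) = - (x + D)"
      using r n by (simp add: parallel_chord_product_def QD xy)
    with U have s: "(y + Q) * (1 + D * x) = - (x + D) * (1 + Q * y)" by algebra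
    have "(V * (1 + D * y) + (y + D)) * (1 + Q * x) = 0"
      using s V by algebra
    then have "V * (1 + D * y) + (y + D) = 0" using n by simp
    then have "V * (1 + D * y) = - (y + D)" by algebra
    then have "V = - (y + D) / (1 + D * y)" by (simp only: nonzero_eq_divide_eq[OF n(2)])
    then show ?thesis by (simp only: parallel_chord_product_def QD xy)
  qed
  note R = poncelet_triples_rotate
  show ?thesis
    using rel *[OF W Z] *[OF R[OF W] R[OF Z]] *[OF R[OF R[OF W]] R[OF R[OF Z]]]
    by (simp add: perpendicular_sides_def)
qed

text \<open>
  Up to the ratio of the sizes of the ellipses, the complex factor that turns the sides of an incircle
  triangle into those of the related triangle. It is invariant under cyclic relabelling, which makes
  the factor of one side that of all three.
\<close>

definition similarity_factor :: "complex \<Rightarrow> complex \<times> complex \<times> complex \<Rightarrow> complex \<times> complex \<times> complex \<Rightarrow> complex" where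
  "similarity_factor D = (\<lambda>(w1, w2, w3) (z1, z2, z3).
     - (1 - D\<^sup>2)\<^sup>2 * (z1 * z2 * z3) * (w1 * w2 * w3) / ((w1\<^sup>2 + D) * (w2\<^sup>2 + D) * (w3\<^sup>2 + D)))"

lemma square_plus_nonzero:
  assumes "cmod w = 1" "\<bar>d\<bar> < 1"
  shows "w\<^sup>2 + of_real d \<noteq> 0"
proof
  assume "w\<^sup>2 + of_real d = 0"
  then have "w\<^sup>2 = - of_real d" by algebra
  then have "cmod (w\<^sup>2) = cmod (- of_real d)" by (rule arg_cong)
  then show False using assms by (simp add: norm_power)
qed

text \<open>
  After division by \<open>(A + B) / 2\<close> the side is \<open>u\<close>, which is split into a chord of the unit circle and the
  factor \<open>1 + D / (z1 * z2)\<close>. Up to the common factor \<open>p\<close> both become rational in the squares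
  of the \<open>w\<close> once the pairwise products of the \<open>z\<close> are substituted.
\<close>

lemma confocal_chord:
  assumes W: "(w1, w2, w3) \<in> poncelet_triples q" and Z: "(z1, z2, z3) \<in> poncelet_triples q"
    and d: "\<bar>d\<bar> < 1" and rel: "perpendicular_sides d (w1, w2, w3) (z1, z2, z3)"
    and ab: "a - b = q * (a + b)" "a + b > 0" and AB: "B - A = d * (A + B)"
  shows "ellipse_complex A B z2 - ellipse_complex A B z1 =
    of_real ((A + B) / (a + b)) * similarity_factor (of_real d) (w1, w2, w3) (z1, z2, z3)
    * (ellipse_complex a b w2 - ellipse_complex a b w1)"
proof -
  note w = poncelet_triplesD[OF W] and z = poncelet_triplesD[OF Z]
  define D :: complex where D: "D = of_real d"
  define x1 x2 x3 where x: "x1 = w1\<^sup>2" "x2 = w2\<^sup>2" "x3 = w3\<^sup>2"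
  define c1 c2 where c: "c1 = cnj z1" "c2 = cnj z2"
  define p where p: "p = z1 * z2 * z3"
  define u where u: "u = z2 - z1 - D * (c2 - c1)"
  have n: "1 + D * x1 \<noteq> 0" "1 + D * x2 \<noteq> 0" "1 + D * x3 \<noteq> 0"
    unfolding D x using one_plus_mult_unit_nonzero[OF _ d] w by (simp_all add: norm_power)
  have m: "x1 + D \<noteq> 0" "x2 + D \<noteq> 0" "x3 + D \<noteq> 0"
    unfolding D x using square_plus_nonzero[OF _ d] w by blast+
  define v1 v2 v3 where v: "v1 = z2 * z3" "v2 = z3 * z1" "v3 = z1 * z2"
  have vn: "v1 * (1 + D * x1) = - (x1 + D)" "v2 * (1 + D * x2) = - (x2 + D)" "v3 * (1 + D * x3) = - (x3 + D)"
    using rel n by (simp_all add: v perpendicular_sides_def parallel_chord_product_def D x)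
  have s1: "v3 * u = (z2 - z1) * (v3 + D)"
    using z(8,9) unfolding u v c by algebra
  have s2: "v1 * v2 * (z2 - z1) = p * (v1 - v2)" unfolding v p by algebra
  have s3: "v1 * v2 * v3 * u = p * (v1 - v2) * (v3 + D)" using s1 s2 by algebra
  have s4: "(v1 - v2) * ((1 + D * x1) * (1 + D * x2)) = (1 - D\<^sup>2) * (x2 - x1)" using vn(1,2) by algebra
  have s5: "(v3 + D) * (1 + D * x3) = - (1 - D\<^sup>2) * x3" using vn(3) by algebra
  have "(v1 * (1 + D * x1)) * (v2 * (1 + D * x2)) * (v3 * (1 + D * x3)) * u =
      p * ((v1 - v2) * ((1 + D * x1) * (1 + D * x2))) * ((v3 + D) * (1 + D * x3))"
    using s3 by algebra
  then have s6: "u * ((x1 + D) * (x2 + D) * (x3 + D)) = p * (1 - D\<^sup>2)\<^sup>2 * ((x2 - x1) * x3)"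
    unfolding vn s4 s5 by algebra
  have chord: "ellipse_complex a b w2 - ellipse_complex a b w1 =
     - of_real ((a + b) / 2) * (x2 - x1) * (w3 * cnj w1 * cnj w2)"
    unfolding x by (rule incircle_chord[OF W ab(1)])
  have r: "(w1 * w2 * w3) * ((x2 - x1) * (w3 * cnj w1 * cnj w2)) = (x2 - x1) * x3"
    unfolding x(3) using w(8,9) by algebra
  have "u = (1 - D\<^sup>2)\<^sup>2 * p * ((x2 - x1) * x3) / ((x1 + D) * (x2 + D) * (x3 + D))"
    using s6 m by (simp add: eq_divide_eq mult_ac)
  also have "\<dots> = - similarity_factor D (w1, w2, w3) (z1, z2, z3) * ((x2 - x1) * (w3 * cnj w1 * cnj w2))"
  proof -
    have "E * P * (Y * X) / M = - (- E * P * Y / M) * X" for E P Y X M :: complex by simp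
    then show ?thesis unfolding similarity_factor_def p prod.case x[symmetric] r[symmetric] by blast
  qed
  finally have u': "u = - similarity_factor D (w1, w2, w3) (z1, z2, z3) * ((x2 - x1) * (w3 * cnj w1 * cnj w2))" .
  have e: "ellipse_complex A B y = of_real ((A + B) / 2) * (y - D * cnj y)" for y
  proof -
    have AB': "(A - B) / 2 = - d * ((A + B) / 2)" using AB by simp
    show ?thesis unfolding ellipse_complex_eq AB' D of_real_mult of_real_minus by algebra
  qed
  have "ellipse_complex A B z2 - ellipse_complex A B z1 = of_real ((A + B) / 2) * u"
    unfolding e u c by (simp only: right_diff_distrib) simp
  also have "\<dots> = of_real ((A + B) / (a + b)) * similarity_factor D (w1, w2, w3) (z1, z2, z3)
    * (- of_real ((a + b) / 2) * (x2 - x1) * (w3 * cnj w1 * cnj w2))"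
  proof -
    have "complex_of_real ((A + B) / 2) = of_real ((A + B) / (a + b)) * of_real ((a + b) / 2)"
      unfolding of_real_mult[symmetric] using ab(2) by simp
    then show ?thesis unfolding u' by algebra
  qed
  finally show ?thesis unfolding chord D .
qed

lemma Re_of_real_mult: "Re (of_real r * z) = r * Re z"
  by simp

lemma corner_cos_similar:
  assumes "K \<noteq> 0" "z2' - z1' = K * (z2 - z1)" "z3' - z1' = K * (z3 - z1)"
  shows "corner_cos z1' z2' z3' = corner_cos z1 z2 z3"
proof -
  have "K * (z2 - z1) * cnj (K * (z3 - z1)) = of_real ((cmod K)\<^sup>2) * ((z2 - z1) * cnj (z3 - z1))"
    by (simp only: complex_norm_square complex_cnj_mult mult_ac)
  then have "Re (K * (z2 - z1) * cnj (K * (z3 - z1))) = (cmod K)\<^sup>2 * Re ((z2 - z1) * cnj (z3 - z1))"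
    by (simp only: Re_of_real_mult)
  then show ?thesis
    unfolding corner_cos_def assms(2,3) using assms(1) by (simp add: norm_mult power2_eq_square)
qed

lemma cosine_triple_confocal:
  assumes W: "(w1, w2, w3) \<in> poncelet_triples q" and Z: "(z1, z2, z3) \<in> poncelet_triples q"
    and d: "\<bar>d\<bar> < 1" and rel: "perpendicular_sides d (w1, w2, w3) (z1, z2, z3)"
    and ab: "a - b = q * (a + b)" "a + b > 0" and AB: "B - A = d * (A + B)" "A + B > 0"
  shows "cosine_triple (ellipse_triangle A B (z1, z2, z3)) = cosine_triple (ellipse_triangle a b (w1, w2, w3))"
proof -
  define K where "K = of_real ((A + B) / (a + b)) * similarity_factor (of_real d) (w1, w2, w3) (z1, z2, z3)"
  note R = poncelet_triples_rotate
  have rel2: "perpendicular_sides d (w2, w3, w1) (z2, z3, z1)" and rel3: "perpendicular_sides d (w3, w1, w2) (z3, z1, z2)"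
    using rel by (auto simp: perpendicular_sides_def)
  have sf: "similarity_factor (of_real d) (w2, w3, w1) (z2, z3, z1) = similarity_factor (of_real d) (w1, w2, w3) (z1, z2, z3)"
    "similarity_factor (of_real d) (w3, w1, w2) (z3, z1, z2) = similarity_factor (of_real d) (w1, w2, w3) (z1, z2, z3)"
    by (simp_all add: similarity_factor_def mult_ac)
  note w = poncelet_triplesD[OF W] and z = poncelet_triplesD[OF Z]
  have "(1 - (of_real d :: complex)\<^sup>2) \<noteq> 0"
    using d by (simp flip: of_real_power add: abs_square_eq_1)
  then have "similarity_factor (of_real d) (w1, w2, w3) (z1, z2, z3) \<noteq> 0"
    using w z square_plus_nonzero[OF _ d] by (auto simp: similarity_factor_def)
  then have K: "K \<noteq> 0"
    using ab AB by (simp add: K_def del: of_real_divide of_real_add)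
  let ?z = "ellipse_complex A B" and ?w = "ellipse_complex a b"
  have c: "?z z2 - ?z z1 = K * (?w w2 - ?w w1)" "?z z3 - ?z z2 = K * (?w w3 - ?w w2)"
     "?z z1 - ?z z3 = K * (?w w1 - ?w w3)"
    using confocal_chord[OF W Z d rel ab AB(1)] confocal_chord[OF R[OF W] R[OF Z] d rel2 ab AB(1)]
      confocal_chord[OF R[OF R[OF W]] R[OF R[OF Z]] d rel3 ab AB(1)]
    unfolding K_def sf by blast+
  have c': "?z z1 - ?z z2 = K * (?w w1 - ?w w2)" "?z z2 - ?z z3 = K * (?w w2 - ?w w3)"
     "?z z3 - ?z z1 = K * (?w w3 - ?w w1)"
    using c by algebra+
  show ?thesis
    unfolding cosine_triple_ellipse_triangle Let_def
    using corner_cos_similar[OF K c(1) c'(3)] corner_cos_similar[OF K c(2) c'(1)] corner_cos_similar[OF K c(3) c'(2)]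
    by simp
qed

lemma cosine_locus_confocal_eq:
  assumes q: "0 \<le> q" "q < 1" and d: "\<bar>d\<bar> < 1" and qd: "q * d\<^sup>2 + q = (3 - q\<^sup>2) * d"
    and ab: "a - b = q * (a + b)" "a + b > 0" and AB: "B - A = d * (A + B)" "A + B > 0"
  shows "cosine_locus (ellipse_triangle A B ` poncelet_triples q)
       = cosine_locus (ellipse_triangle a b ` poncelet_triples q)"
proof (rule set_eqI, rule iffI)
  fix c assume "c \<in> cosine_locus (ellipse_triangle a b ` poncelet_triples q)"
  then obtain w1 w2 w3 where W: "(w1, w2, w3) \<in> poncelet_triples q"
    and c: "c = cosine_triple (ellipse_triangle a b (w1, w2, w3))" by (auto simp: cosine_locus_def)
  from ex_perpendicular_sides[OF W q d qd] obtain z1 z2 z3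
    where Z: "(z1, z2, z3) \<in> poncelet_triples q" and "perpendicular_sides d (w1, w2, w3) (z1, z2, z3)" by auto
  from cosine_triple_confocal[OF W Z d this(2) ab AB] Z
  show "c \<in> cosine_locus (ellipse_triangle A B ` poncelet_triples q)"
    unfolding c cosine_locus_def by (metis imageI)
next
  fix c assume "c \<in> cosine_locus (ellipse_triangle A B ` poncelet_triples q)"
  then obtain z1 z2 z3 where Z: "(z1, z2, z3) \<in> poncelet_triples q"
    and c: "c = cosine_triple (ellipse_triangle A B (z1, z2, z3))" by (auto simp: cosine_locus_def)
  from ex_perpendicular_sides[OF Z q d qd] obtain w1 w2 w3
    where W: "(w1, w2, w3) \<in> poncelet_triples q" and r: "perpendicular_sides d (z1, z2, z3) (w1, w2, w3)" by auto
  from cosine_triple_confocal[OF W Z d perpendicular_sides_sym[OF Z W q d r] ab AB] W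
  show "c \<in> cosine_locus (ellipse_triangle a b ` poncelet_triples q)"
    unfolding c cosine_locus_def by (metis imageI)
qed

section \<open>The loci of both families\<close>

lemma sphere_eq_ellipse:
  assumes "r > 0" shows "sphere 0 r = ellipse r r"
proof -
  have "norm p = r \<longleftrightarrow> (p$1)\<^sup>2 / r\<^sup>2 + (p$2)\<^sup>2 / r\<^sup>2 = 1" for p :: "real^2"
  proof -
    have "norm p = r \<longleftrightarrow> (norm p)\<^sup>2 = r\<^sup>2" using assms by simp
    also have "(norm p)\<^sup>2 = (p$1)\<^sup>2 + (p$2)\<^sup>2"
      by (simp add: norm_vec_def L2_set_def sum_2)
    also have "\<dots> = r\<^sup>2 \<longleftrightarrow> (p$1)\<^sup>2 / r\<^sup>2 + (p$2)\<^sup>2 / r\<^sup>2 = 1"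
      using assms by (auto simp flip: add_divide_distrib)
    finally show ?thesis .
  qed
  then show ?thesis by (simp only: ellipse_def sphere_def dist_0_norm)
qed

lemma scale_triangle_ellipse_triangle:
  "scale_triangle s (ellipse_triangle a b w) = ellipse_triangle (s * a) b w"
  by (cases w) (simp add: scale_triangle_def scale_x_def ellipse_triangle_def ellipse_point_def mult.assoc)

text \<open>
  The assumption on \<open>A^2\<close> and \<open>B^2\<close> is the equality of \<open>B^2 - A^2\<close> for the two ellipses, up to a factor 4.
\<close>

lemma is_confocal_family_ellipse_triangles:
  assumes A: "0 < A" "A \<le> B" and q: "0 \<le> q" "q < 1"
    and conf: "A\<^sup>2 * ((1 + q) * (3 - q)) = B\<^sup>2 * ((1 - q) * (3 + q))"
  shows "is_confocal_family A B (A * (1 - q) / 2) (B * (1 + q) / 2)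
           (ellipse_triangle A B ` poncelet_triples q)"
proof -
  let ?A = "A * (1 - q) / 2" and ?B = "B * (1 + q) / 2"
  have B: "B > 0" using A by simp
  have diff: "B\<^sup>2 - A\<^sup>2 = ?B\<^sup>2 - ?A\<^sup>2"
  proof -
    have e: "4 * (B\<^sup>2 - A\<^sup>2) - 4 * (?B\<^sup>2 - ?A\<^sup>2) = B\<^sup>2 * ((1 - q) * (3 + q)) - A\<^sup>2 * ((1 + q) * (3 - q))"
      by (simp add: power2_eq_square field_simps)
    have "X = Y" if "4 * X - 4 * Y = 0" for X Y :: real using that by simp
    moreover have "4 * (B\<^sup>2 - A\<^sup>2) - 4 * (?B\<^sup>2 - ?A\<^sup>2) = 0" unfolding e conf by simp
    ultimately show ?thesis by blast
  qed
  have pos: "0 < ?A" "?A < A" "0 < ?B" "?B < B"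
    using A B q by (simp_all add: field_simps add_pos_nonneg)
  have le: "B \<le> A \<longleftrightarrow> ?B \<le> ?A"
  proof -
    have "B \<le> A \<longleftrightarrow> B\<^sup>2 - A\<^sup>2 \<le> 0" using A B power_mono_iff[of B A 2] by simp
    moreover have "?B \<le> ?A \<longleftrightarrow> ?B\<^sup>2 - ?A\<^sup>2 \<le> 0" using pos power_mono_iff[of ?B ?A 2] by simp
    ultimately show ?thesis using diff by simp
  qed
  have diff': "A\<^sup>2 - B\<^sup>2 = ?A\<^sup>2 - ?B\<^sup>2" using diff by linarith
  have "ellipse_foci A B = ellipse_foci ?A ?B"
    unfolding ellipse_foci_def le diff diff' ..
  moreover have "ellipse_triangle A B ` poncelet_triples q = poncelet_family (ellipse A B) (ellipse ?A ?B)"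
    using poncelet_family_eq_image[OF A(1) B q] by simp
  ultimately show ?thesis
    using pos ex_poncelet_triple[OF q] unfolding is_confocal_family_def by blast
qed

theorem theorem1:
  fixes a b k s :: real and I C :: "triangle set"
  assumes "a \<ge> b" and "b > 0"
    and "k = 1 + 2 * a * b / (a + b)\<^sup>2"
    and "s = sqrt ((b^4 + 2 * a * b^3) / (a^4 + 2 * b * a^3))"
    and "I = incircle_family a b"
    and "C = scale_triangle s ` I"
  shows "is_confocal_family (s * a) b (s * (a * b / (a + b))) (a * b / (a + b)) C
    \<and> equilateral_cubic (Delta k)
    \<and> cosine_locus I = Delta_curve k \<inter> {c. \<forall>i. \<bar>c $ i\<bar> \<le> 1}
    \<and> cosine_locus C = Delta_curve k \<inter> {c. \<forall>i. \<bar>c $ i\<bar> \<le> 1}"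
proof -
  have a: "a > 0" and b: "b > 0" using assms by simp_all
  define q where "q = (a - b) / (a + b)"
  have ab: "a - b = q * (a + b)" "a + b > 0" using a b by (simp_all add: q_def)
  have q: "0 \<le> q" "q < 1" using assms(1) a b by (simp_all add: q_def)
  have r: "a * b / (a + b) = a * (1 - q) / 2" "a * b / (a + b) = b * (1 + q) / 2"
    using ab(2) by (simp_all add: q_def field_simps)
  have k: "k = (3 - q\<^sup>2) / 2"
  proof -
    have "4 * a * b = (1 - q\<^sup>2) * (a + b)\<^sup>2" using ab(1) by algebra
    then have "2 * a * b = (1 - q\<^sup>2) / 2 * (a + b)\<^sup>2" by simp
    then have "2 * a * b / (a + b)\<^sup>2 = (1 - q\<^sup>2) / 2" using ab(2) by simp
    then show ?thesis unfolding assms(3) by (simp add: field_simps)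
  qed
  have "a * b / (a + b) > 0" using a b by simp
  then have "I = poncelet_family (ellipse a b) (ellipse (a * b / (a + b)) (a * b / (a + b)))"
    unfolding assms(5) incircle_family_def by (simp only: sphere_eq_ellipse)
  also have "\<dots> = poncelet_family (ellipse a b) (ellipse (a * (1 - q) / 2) (b * (1 + q) / 2))"
    by (rule arg_cong2[where f = "\<lambda>x y. poncelet_family (ellipse a b) (ellipse x y)", OF r])
  finally have "I = poncelet_family (ellipse a b) (ellipse (a * (1 - q) / 2) (b * (1 + q) / 2))" .
  then have I: "I = ellipse_triangle a b ` poncelet_triples q"
    using poncelet_family_eq_image[OF a b q] by simp
  have s: "s > 0" unfolding assms(4) using a b by (simp add: add_pos_pos)
  \<comment> \<open>The value of \<open>s\<close> is chosen to make the outer and the inner ellipse confocal.\<close>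
  have conf: "(s * a)\<^sup>2 * ((1 + q) * (3 - q)) = b\<^sup>2 * ((1 - q) * (3 + q))"
  proof -
    have "s\<^sup>2 = (b^4 + 2 * a * b^3) / (a^4 + 2 * b * a^3)"
      unfolding assms(4) using a b by (simp add: add_nonneg_nonneg)
    also have "\<dots> = (b^3 * (b + 2 * a)) / (a^3 * (a + 2 * b))"
      by (simp add: eval_nat_numeral algebra_simps)
    finally have "s\<^sup>2 * (a^3 * (a + 2 * b)) = b^3 * (b + 2 * a)" using a b by simp
    then have "a * ((s * a)\<^sup>2 * (a + 2 * b)) = b\<^sup>2 * (b * (b + 2 * a))" by algebra
    moreover have "(1 + q) * (a + b) = 2 * a" "(3 - q) * (a + b) = 2 * (a + 2 * b)"
      "(1 - q) * (a + b) = 2 * b" "(3 + q) * (a + b) = 2 * (b + 2 * a)"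
      using ab(1) by (simp_all add: algebra_simps)
    ultimately have "((s * a)\<^sup>2 * ((1 + q) * (3 - q))) * (a + b)\<^sup>2 = (b\<^sup>2 * ((1 - q) * (3 + q))) * (a + b)\<^sup>2"
      by algebra
    then show ?thesis using ab(2) by simp
  qed
  have sa: "0 < s * a" using s a by simp
  have le: "s * a \<le> b"
  proof -
    have "(1 - q) * (3 + q) \<le> (1 + q) * (3 - q)" using q by (simp add: algebra_simps)
    then have "b\<^sup>2 * ((1 - q) * (3 + q)) \<le> b\<^sup>2 * ((1 + q) * (3 - q))" by (rule mult_left_mono) simp
    then have "(s * a)\<^sup>2 * ((1 + q) * (3 - q)) \<le> b\<^sup>2 * ((1 + q) * (3 - q))" using conf by simp
    then have "(s * a)\<^sup>2 \<le> b\<^sup>2" using q by simp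
    then show ?thesis by (rule power2_le_imp_le) (use b in simp)
  qed
  have C: "C = ellipse_triangle (s * a) b ` poncelet_triples q"
    unfolding assms(6) I image_image scale_triangle_ellipse_triangle ..
  have "is_confocal_family (s * a) b (s * (a * b / (a + b))) (a * b / (a + b)) C"
  proof -
    have 1: "s * (a * b / (a + b)) = s * a * (1 - q) / 2" unfolding r(1) by simp
    show ?thesis
      unfolding 1 C unfolding r(2) by (rule is_confocal_family_ellipse_triangles[OF sa le q conf])
  qed
  moreover have "cosine_locus C = cosine_locus I"
  proof -
    define d where "d = (b - s * a) / (s * a + b)"
    have p: "s * a + b > 0" using sa b by simp
    have dd: "b - s * a = d * (s * a + b)" using p by (simp add: d_def)
    have d: "\<bar>d\<bar> < 1" using sa b le p by (simp add: d_def)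
    \<comment> \<open>In terms of \<open>d\<close>, this is the confocality equation again.\<close>
    have "((q * d\<^sup>2 + q) - (3 - q\<^sup>2) * d) * (s * a + b)\<^sup>2 = 0"
      using dd conf by algebra
    then have "q * d\<^sup>2 + q = (3 - q\<^sup>2) * d" using p by simp
    from cosine_locus_confocal_eq[OF q d this ab dd p] show ?thesis unfolding C I .
  qed
  moreover have "cosine_locus I = Delta_curve k \<inter> {c. \<forall>i. \<bar>c $ i\<bar> \<le> 1}"
    unfolding I k by (rule cosine_locus_incircle[OF q ab])
  ultimately show ?thesis using equilateral_cubic_Delta by simp
qed

end
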